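(* Assume the standing assumptions (i)--(iii), the bounded-iterates assumption, and $M\ge L_2$ (all in the context). Fix $p\ge 3$ and $c_{\mathrm{mix}}\ge 0$, and run DisGrem with the logarithmic mixing schedule $$\tau_k=t_k=\Bigl\lceil \frac{p\log(k+2)+c_{\mathrm{mix}}}{-\log\rho}\Bigr\rceil,\qquad k\ge 0 .$$ For $0<\varepsilon\le 1$ let $K(\varepsilon)$ be the number of outer iterations needed to achieve $\|\nabla f(\bar x_k)\|\le\varepsilon$, i.e. the first $k\ge 0$ with $\|\nabla f(\bar x_k)\|\le\varepsilon$. Then for every $0<\varepsilon\le 1$ there exist a finite burn-in index $K_0(\varepsilon)$ for $\varepsilon$ (in the sense defined in the context; it depends on the spectral gap $1-\rho$, the Lipschitz constants, the initial dispersions, and $\varepsilon$) and a constant $C_K>0$ independent of $\varepsilon$ such that $$K(\varepsilon)\le K_0(\varepsilon)+C_K\,\varepsilon^{-1}.$$ In particular at most $\mathcal O(\varepsilon^{-1})$ iterations are needed after the burn-in index. Moreover (since $p\ge 3$) the burn-in indices can be taken with $K_0(\varepsilon)=\mathcal O(\varepsilon^{-1})$, so that $K(\varepsilon)=\mathcal O(\varepsilon^{-1})$; and for a fixed connected network the total number of neighbor communication rounds $\sum_{k=0}^{K(\varepsilon)-1}(\tau_k+2t_k)$ is $\mathcal O(\varepsilon^{-1}\log(1/\varepsilon))$. More explicitly, its dependence on the mixing rate is $\mathcal O((1-\rho)^{-1}\varepsilon^{-1}\log(1/\varepsilon))$ as $\rho\to 1$.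
   Context: Norms: $\|\cdot\|$ is the Euclidean norm for (stacked) vectors; $\|\cdot\|_2$ is the spectral norm for matrices. Problem and standing assumptions. $f=\frac1N\sum_{i=1}^N f_i$ with $f_i:\mathbb R^d\to\mathbb R$. (i) Each $f_i$ is convex, twice continuously differentiable, with $\|\nabla f_i(x)-\nabla f_i(y)\|\le L_1\|x-y\|$ and $\|\nabla^2 f_i(x)-\nabla^2 f_i(y)\|_2\le L_2\|x-y\|$ for all $x,y$. (ii) $W\in\mathbb R^{N\times N}$ is entrywise nonnegative, symmetric, doubly stochastic, with positive diagonal (its off-diagonal support is contained in the edge set of a connected undirected graph), and $\rho:=\|W-\frac1N\mathbf 1\mathbf 1^\top\|_2<1$. (iii) $f$ is coercive. The logarithmic schedule presupposes $\rho\in(0,1)$. Algorithm DisGrem. Inputs: $x_{i,0}\in\mathbb R^d$ ($i=1,\dots,N$), $M>0$, integers $\tau_k,t_k\ge1$. Initialize $g_{i,0}=\nabla f_i(x_{i,0})$, $H_{i,0}=\nabla^2 f_i(x_{i,0})$. For $k\ge 0$: (A) $\tilde x_{i,k}=\sum_j[W^{\tau_k}]_{ij}x_{j,k}$, $\tilde g_{i,k}=\sum_j[W^{\tau_k}]_{ij}g_{j,k}$, $\tilde H_{i,k}=\sum_j[W^{\tau_k}]_{ij}H_{j,k}$. (B) $\lambda_{i,k}=\sqrt{M\|\tilde g_{i,k}\|}$, $\delta_{i,k}=\max\{0,-\lambda_{\min}(\tilde H_{i,k})\}$; if $\tilde g_{i,k}=0$ then $s_{i,k}=0$, otherwise $s_{i,k}$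 solves $(\tilde H_{i,k}+(\lambda_{i,k}+\delta_{i,k})I)s_{i,k}=-\tilde g_{i,k}$. (C) $x_{i,k+1}=\sum_j[W^{t_k}]_{ij}(\tilde x_{j,k}+s_{j,k})$. (D) $g_{i,k+1}=\sum_j[W^{t_k}]_{ij}(\tilde g_{j,k}+\nabla f_j(x_{j,k+1})-\nabla f_j(x_{j,k}))$ and $H_{i,k+1}=\sum_j[W^{t_k}]_{ij}(\tilde H_{j,k}+\nabla^2 f_j(x_{j,k+1})-\nabla^2 f_j(x_{j,k}))$. Iteration $k$ uses $\tau_k+2t_k$ neighbor communication rounds. Bounded-iterates assumption. There are $x_\star\in\arg\min f$ and a finite $D>0$ such that $\|\bar x_k-x_\star\|\le D$, $\|x_{i,k}-x_\star\|\le D$, $\|\tilde x_{i,k}-x_\star\|\le D$ for all $k\ge0$ and all $i$. Notation. $\bar x_k=\frac1N\sum_i x_{i,k}$, $\bar s_k=\frac1N\sum_i s_{i,k}$, $\tilde{\bar g}_k=\frac1N\sum_i\tilde g_{i,k}$, $\tilde{\bar H}_k=\frac1N\sum_i\tilde H_{i,k}$, $\bar\delta_k=\frac1N\sum_i\delta_{i,k}$, $\lambda_k=\frac1N\sum_i(\lambda_{i,k}+\delta_{i,k})$, $g_k=\nabla f(\bar x_k)$, $M_{H,\max}=L_1$. $D(X_k)=\bigl(\frac1N\sum_i\|x_{i,k}-\bar x_k\|^2\bigr)^{1/2}$ (not to be confused with the constant $D$). $\Delta_k^g=\frac1N\sum_i\|\tilde g_{i,k}-\tilde{\bar g}_k\|$,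 $\Delta_k^H=\frac1N\sum_i\|\tilde H_{i,k}-\tilde{\bar H}_k\|_2$. When $A_k^{\mathrm{ref}}:=\tilde{\bar H}_k+\lambda_kI$ is nonsingular, $s_k^{\mathrm{ref}}:=-(A_k^{\mathrm{ref}})^{-1}\tilde{\bar g}_k$. Burn-in index for $\varepsilon$. An integer $K_0\ge 0$ such that, with $\eta=1/12$: for every $k\ge K_0$ with $\|g_k\|\ge\varepsilon$, $A_k^{\mathrm{ref}}$ is nonsingular and (1) $\|\bar s_k-s_k^{\mathrm{ref}}\|\le\frac{\eta}{8}\frac{\lambda_k}{M_{H,\max}+\lambda_k}\|\bar s_k\|$, (2) $L_1D(X_k)\le\frac{\eta}{8}\lambda_k\|\bar s_k\|$, (3) $L_2D(X_k)\le\frac{\eta}{8}\lambda_k$; and for every $k\ge K_0$: $\Delta_k^g\le\varepsilon^2$, $\Delta_k^H\le\varepsilon^{3/2}$, $D(X_k)\le\varepsilon^{3/2}$, $\bar\delta_k\le(1+L_2)\varepsilon^{3/2}$. $\mathcal O$-convention. $\mathcal O(\cdot)$ is as $\varepsilon\downarrow0$, with hidden constants independent of $\varepsilon$; they (as well as $C_K$ and $K_0$) may depend on $d,N,L_1,L_2,D,M,p,c_{\mathrm{mix}}$, the initial data and the spectral gap. The displayed factor $(1-\rho)^{-1}$ records the dependence on $\rho$ coming from the per-iteration mixing depth, $-1/\log\rho=\Theta((1-\rho)^{-1})$ as $\rho\to1$. *)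

theory Defs
  imports "HOL-Analysis.Analysis"
begin

definition avg :: "('n::finite \<Rightarrow> 'b::real_vector) \<Rightarrow> 'b" where
  "avg v = (1 / real CARD('n)) *\<^sub>R (\<Sum>i\<in>UNIV. v i)"

definition favg :: "('n::finite \<Rightarrow> 'a \<Rightarrow> real) \<Rightarrow> 'a \<Rightarrow> real" where
  "favg f x = avg (\<lambda>i. f i x)"

definition grad :: "(real^'d \<Rightarrow> real) \<Rightarrow> real^'d \<Rightarrow> real^'d" where
  "grad h x = (THE v. GDERIV h x :> v)"

definition hess :: "(real^'d \<Rightarrow> real) \<Rightarrow> real^'d \<Rightarrow> real^'d^'d" where
  "hess h x = jacobian (grad h) (at x)"

definition twice_cont_diff :: "(real^'d \<Rightarrow> real) \<Rightarrow> bool" where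
  "twice_cont_diff h \<longleftrightarrow>
     (\<forall>x. h differentiable at x) \<and> (\<forall>x. grad h differentiable at x) \<and>
     continuous_on UNIV (hess h)"

text \<open>The library norm on \<^typ>\<open>real^'d^'d\<close> is the Frobenius norm, hence the explicit
  operator norm.\<close>

definition spec_norm :: "real^'d^'d \<Rightarrow> real" where
  "spec_norm A = onorm ((*v) A)"

text \<open>Only meaningful for matrices having a least real eigenvalue, e.g. symmetric ones.\<close>

definition lambda_min :: "real^'d^'d \<Rightarrow> real" where
  "lambda_min A = (LEAST c. \<exists>v. v \<noteq> 0 \<and> A *v v = c *\<^sub>R v)"

text \<open>The library operation \<open>^\<close> on \<^typ>\<open>real^'n^'n\<close> is the entrywise power.\<close>

definition mpow :: "real^'n^'n \<Rightarrow> nat \<Rightarrow> real^'n^'n" where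
  "mpow A m = (((**) A) ^^ m) (mat 1)"

definition mix :: "real^'n^'n \<Rightarrow> ('n \<Rightarrow> 'b::real_vector) \<Rightarrow> 'n \<Rightarrow> 'b" where
  "mix A v i = (\<Sum>j\<in>UNIV. (A $ i $ j) *\<^sub>R v j)"

definition smooth_convex :: "('n \<Rightarrow> real^'d \<Rightarrow> real) \<Rightarrow> real \<Rightarrow> real \<Rightarrow> bool" where
  "smooth_convex f L1 L2 \<longleftrightarrow>
     (\<forall>i. convex_on UNIV (f i) \<and> twice_cont_diff (f i) \<and>
        (\<forall>x y. norm (grad (f i) x - grad (f i) y) \<le> L1 * norm (x - y)) \<and>
        (\<forall>x y. spec_norm (hess (f i) x - hess (f i) y) \<le> L2 * norm (x - y)))"

definition mixing_matrix :: "real^'n^'n \<Rightarrow> bool" where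
  "mixing_matrix W \<longleftrightarrow>
     (\<forall>i j. 0 \<le> W $ i $ j) \<and> transpose W = W \<and>
     (\<forall>i. (\<Sum>j\<in>UNIV. W $ i $ j) = 1) \<and> (\<forall>j. (\<Sum>i\<in>UNIV. W $ i $ j) = 1) \<and>
     (\<forall>i. 0 < W $ i $ i) \<and>
     (\<exists>E :: ('n \<times> 'n) set. sym E \<and> irrefl E \<and> (\<forall>i j. (i, j) \<in> E\<^sup>*) \<and>
        (\<forall>i j. i \<noteq> j \<and> W $ i $ j \<noteq> 0 \<longrightarrow> (i, j) \<in> E))"

definition mixing_rate :: "real^'n^'n \<Rightarrow> real" where
  "mixing_rate W = spec_norm (W - (\<chi> i j. 1 / real CARD('n)))"

definition coercive :: "(real^'d \<Rightarrow> real) \<Rightarrow> bool" where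
  "coercive h \<longleftrightarrow> filterlim h at_top at_infinity"

text \<open>All variables of a run, indexed by iteration and agent; the prefix \<open>m\<close> marks the
  mixed (tilde) quantities.\<close>

record ('d, 'n) run =
  X :: "nat \<Rightarrow> 'n \<Rightarrow> real^'d"
  mX :: "nat \<Rightarrow> 'n \<Rightarrow> real^'d"
  G :: "nat \<Rightarrow> 'n \<Rightarrow> real^'d"
  mG :: "nat \<Rightarrow> 'n \<Rightarrow> real^'d"
  H :: "nat \<Rightarrow> 'n \<Rightarrow> real^'d^'d"
  mH :: "nat \<Rightarrow> 'n \<Rightarrow> real^'d^'d"
  S :: "nat \<Rightarrow> 'n \<Rightarrow> real^'d"

definition lam :: "real \<Rightarrow> ('d::finite, 'n::finite) run \<Rightarrow> nat \<Rightarrow> 'n \<Rightarrow> real" where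
  "lam M r k i = sqrt (M * norm (mG r k i))"

definition del :: "('d::finite, 'n::finite) run \<Rightarrow> nat \<Rightarrow> 'n \<Rightarrow> real" where
  "del r k i = max 0 (- lambda_min (mH r k i))"

definition disgrem ::
  "('n::finite \<Rightarrow> real^'d::finite \<Rightarrow> real) \<Rightarrow> real^'n^'n \<Rightarrow> real \<Rightarrow> (nat \<Rightarrow> nat) \<Rightarrow> (nat \<Rightarrow> nat)
     \<Rightarrow> ('d, 'n) run \<Rightarrow> bool" where
  "disgrem f W M \<tau> t r \<longleftrightarrow>
     0 < M \<and> (\<forall>k. 1 \<le> \<tau> k \<and> 1 \<le> t k) \<and>
     (\<forall>i. G r 0 i = grad (f i) (X r 0 i)) \<and>
     (\<forall>i. H r 0 i = hess (f i) (X r 0 i)) \<and>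
     (\<forall>k i. mX r k i = mix (mpow W (\<tau> k)) (X r k) i \<and>
            mG r k i = mix (mpow W (\<tau> k)) (G r k) i \<and>
            mH r k i = mix (mpow W (\<tau> k)) (H r k) i) \<and>
     (\<forall>k i. if mG r k i = 0 then S r k i = 0
            else (mH r k i + (lam M r k i + del r k i) *\<^sub>R mat 1) *v S r k i = - mG r k i) \<and>
     (\<forall>k i. X r (Suc k) i = mix (mpow W (t k)) (\<lambda>j. mX r k j + S r k j) i) \<and>
     (\<forall>k i. G r (Suc k) i = mix (mpow W (t k))
        (\<lambda>j. mG r k j + grad (f j) (X r (Suc k) j) - grad (f j) (X r k j)) i) \<and>
     (\<forall>k i. H r (Suc k) i = mix (mpow W (t k))
        (\<lambda>j. mH r k j + hess (f j) (X r (Suc k) j) - hess (f j) (X r k j)) i)"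

definition bounded_iterates ::
  "('n::finite \<Rightarrow> real^'d::finite \<Rightarrow> real) \<Rightarrow> real \<Rightarrow> ('d, 'n) run \<Rightarrow> bool" where
  "bounded_iterates f D r \<longleftrightarrow>
     (\<exists>xs. (\<forall>y. favg f xs \<le> favg f y) \<and>
        (\<forall>k. norm (avg (X r k) - xs) \<le> D \<and>
           (\<forall>i. norm (X r k i - xs) \<le> D \<and> norm (mX r k i - xs) \<le> D)))"

definition log_schedule :: "real \<Rightarrow> real \<Rightarrow> real \<Rightarrow> nat \<Rightarrow> nat" where
  "log_schedule p c \<rho> k = nat \<lceil>(p * ln (real k + 2) + c) / (- ln \<rho>)\<rceil>"

definition gbar :: "('n::finite \<Rightarrow> real^'d::finite \<Rightarrow> real) \<Rightarrow> ('d, 'n) run \<Rightarrow> nat \<Rightarrow> real^'d" where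
  "gbar f r k = grad (favg f) (avg (X r k))"

definition lambar :: "real \<Rightarrow> ('d::finite, 'n::finite) run \<Rightarrow> nat \<Rightarrow> real" where
  "lambar M r k = avg (\<lambda>i. lam M r k i + del r k i)"

definition disp_X :: "('d::finite, 'n::finite) run \<Rightarrow> nat \<Rightarrow> real" where
  "disp_X r k = sqrt (avg (\<lambda>i. (norm (X r k i - avg (X r k)))\<^sup>2))"

definition disp_G :: "('d::finite, 'n::finite) run \<Rightarrow> nat \<Rightarrow> real" where
  "disp_G r k = avg (\<lambda>i. norm (mG r k i - avg (mG r k)))"

definition disp_H :: "('d::finite, 'n::finite) run \<Rightarrow> nat \<Rightarrow> real" where
  "disp_H r k = avg (\<lambda>i. spec_norm (mH r k i - avg (mH r k)))"

definition A_ref :: "real \<Rightarrow> ('d::finite, 'n::finite) run \<Rightarrow> nat \<Rightarrow> real^'d^'d" where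
  "A_ref M r k = avg (mH r k) + lambar M r k *\<^sub>R mat 1"

definition s_ref :: "real \<Rightarrow> ('d::finite, 'n::finite) run \<Rightarrow> nat \<Rightarrow> real^'d" where
  "s_ref M r k = - (matrix_inv (A_ref M r k) *v avg (mG r k))"

definition burn_in_eta :: real where
  "burn_in_eta = 1 / 12"

text \<open>\<open>L1\<close> in the first bound is the Hessian bound: Hessians have spectral norm at most \<open>L1\<close>.\<close>

definition burn_in ::
  "real \<Rightarrow> real \<Rightarrow> real \<Rightarrow> ('n::finite \<Rightarrow> real^'d::finite \<Rightarrow> real) \<Rightarrow> ('d, 'n) run
     \<Rightarrow> real \<Rightarrow> nat \<Rightarrow> bool" where
  "burn_in L1 L2 M f r \<epsilon> K0 \<longleftrightarrow>
     (\<forall>k\<ge>K0. norm (gbar f r k) \<ge> \<epsilon> \<longrightarrow>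
        invertible (A_ref M r k) \<and>
        norm (avg (S r k) - s_ref M r k)
          \<le> burn_in_eta / 8 * (lambar M r k / (L1 + lambar M r k)) * norm (avg (S r k)) \<and>
        L1 * disp_X r k \<le> burn_in_eta / 8 * lambar M r k * norm (avg (S r k)) \<and>
        L2 * disp_X r k \<le> burn_in_eta / 8 * lambar M r k) \<and>
     (\<forall>k\<ge>K0. disp_G r k \<le> \<epsilon>\<^sup>2 \<and>
        disp_H r k \<le> \<epsilon> powr (3 / 2) \<and>
        disp_X r k \<le> \<epsilon> powr (3 / 2) \<and>
        avg (del r k) \<le> (1 + L2) * \<epsilon> powr (3 / 2))"

definition reaches ::
  "('n::finite \<Rightarrow> real^'d::finite \<Rightarrow> real) \<Rightarrow> ('d, 'n) run \<Rightarrow> real \<Rightarrow> bool" where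
  "reaches f r \<epsilon> \<longleftrightarrow> (\<exists>k. norm (gbar f r k) \<le> \<epsilon>)"

text \<open>Only meaningful when \<^term>\<open>reaches f r \<epsilon>\<close> holds.\<close>

definition hit_time ::
  "('n::finite \<Rightarrow> real^'d::finite \<Rightarrow> real) \<Rightarrow> ('d, 'n) run \<Rightarrow> real \<Rightarrow> nat" where
  "hit_time f r \<epsilon> = (LEAST k. norm (gbar f r k) \<le> \<epsilon>)"

definition comm_rounds :: "(nat \<Rightarrow> nat) \<Rightarrow> (nat \<Rightarrow> nat) \<Rightarrow> nat \<Rightarrow> nat" where
  "comm_rounds \<tau> t n = (\<Sum>k<n. \<tau> k + 2 * t k)"

end

theory Submission
  imports Defs
begin

text \<open>
  \<^emph>\<open>Consensus.\<close>  On deviations from the average a doubly stochastic \<open>W\<close> acts like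
  \<open>W - (1/N) 1 1\<^sup>T\<close>, so each mixing of iteration \<open>k\<close> with the logarithmic schedule divides every
  dispersion by at least \<open>(k + 2)\<^sup>3\<close> (\<open>dispersion_mix_mpow\<close>, \<open>log_schedule_contraction\<close>).
  Because the iterates stay bounded, each iteration adds only a bounded dispersion.  Hence the
  dispersions are \<open>O(k\<^bsup>-3\<^esup>)\<close> for the iterates and \<open>O(k\<^bsup>-6\<^esup>)\<close> for the mixed trackers, which
  are contracted twice (\<open>tracker_decay\<close>, \<open>run_bounds\<close>).  The constants depend only on the data
  of the problem and on the initial trackers.

  \<^emph>\<open>Burn-in.\<close>  While the gradient is at least \<open>\<epsilon>\<close>, the regularisation and the averaged step
  are at least of order \<open>\<epsilon>\<close>, so the right-hand sides of the burn-in inequalities are at least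
  of order \<open>\<epsilon>\<^sup>2\<close>.  Their left-hand sides are \<open>O(k\<^bsup>-3\<^esup> / \<epsilon>)\<close>, the worst being the
  disagreement of the regularisations \<open>sqrt (M |g|)\<close>, which has the order of the square root of
  the gradient dispersion (\<open>step_error\<close>).  So \<open>k \<ge> K / \<epsilon>\<close> with a large constant \<open>K\<close> is enough
  (\<open>burn_in_step\<close>, \<open>burn_in_index\<close>).  Symmetry and positive semidefiniteness of the Hessians,
  and the variational description of \<^const>\<open>lambda_min\<close>, show that the eigenvalue shifts only
  compensate for the dispersion of the Hessian trackers.

  \<^emph>\<open>Decrease.\<close>  After the burn-in the averaged step \<open>s\<close> is nearly a regularised Newton step for
  the mean objective, and Taylor expansion gives that the next gradient is \<open>- \<lambda> s\<close> up to an
  error of at most \<open>3/4\<close> of the norm of \<open>\<lambda> s\<close> (\<open>next_gradient\<close>).  By convexity the objective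
  then decreases by at least a constant times the squared next gradient
  (\<open>objective_decrease\<close>).  Since the gap to the minimum is at most \<open>D\<close> times the gradient, the
  gap is \<open>O(1/j)\<close> after \<open>j\<close> steps.  So \<open>O(1/\<epsilon>)\<close> steps bring it to \<open>O(\<epsilon>)\<close>, and as each further
  step with gradient above \<open>\<epsilon>\<close> lowers it by a constant times \<open>\<epsilon>\<^sup>2\<close>, only \<open>O(1/\<epsilon>)\<close> of these follow
  (\<open>small_gradient_index\<close>).

  \<^emph>\<open>Communication.\<close>  Because \<open>1 - \<rho> \<le> - ln \<rho>\<close>, each of the first \<open>O(1/\<epsilon>)\<close> iterations costs
  \<open>O(ln (1/\<epsilon>) / (1 - \<rho>))\<close> rounds (\<open>comm_rounds_le\<close>).
\<close>

section \<open>Averages and mixing\<close>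

lemma avg_add: "avg (\<lambda>i. u i + v i) = avg u + avg v"
  by (simp add: avg_def sum.distrib scaleR_add_right)

lemma avg_diff: "avg (\<lambda>i. u i - v i) = avg u - avg v"
  by (simp add: avg_def sum_subtractf scaleR_diff_right)

lemma avg_const [simp]: "avg (\<lambda>i::'n::finite. c) = c"
  by (simp add: avg_def sum_constant_scaleR)

lemma avg_bounded_linear: "bounded_linear h \<Longrightarrow> h (avg v) = avg (\<lambda>i. h (v i))"
  by (simp add: avg_def linear_simps linear_sum bounded_linear.linear)

lemma avg_mult_right: "avg (\<lambda>i. c * a i) = c * avg (a :: _ \<Rightarrow> real)"
  by (simp add: avg_def sum_distrib_left[symmetric])

lemma avg_mono:
  fixes a b :: "'n::finite \<Rightarrow> real"
  assumes "\<And>i. a i \<le> b i"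
  shows "avg a \<le> avg b"
  unfolding avg_def using assms by (intro scaleR_left_mono sum_mono) auto

lemma avg_le:
  fixes a :: "'n::finite \<Rightarrow> real"
  shows "(\<And>i. a i \<le> c) \<Longrightarrow> avg a \<le> c"
  using avg_mono[of a "\<lambda>_. c"] by simp

lemma avg_ge:
  fixes a :: "'n::finite \<Rightarrow> real"
  shows "(\<And>i. c \<le> a i) \<Longrightarrow> c \<le> avg a"
  using avg_mono[of "\<lambda>_. c" a] by simp

lemma norm_avg_le: "norm (avg v) \<le> avg (\<lambda>i. norm (v i))"
  unfolding avg_def by (simp add: norm_sum divide_right_mono)

lemma norm_avg_le_bound: "(\<And>i. norm (v i) \<le> c) \<Longrightarrow> norm (avg v) \<le> c"
  using norm_avg_le[of v] avg_le[of "\<lambda>i. norm (v i)" c] by (meson order_trans)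

text \<open>The unnormalised Euclidean norm is used, rather than the root mean square, so that it
  bounds the deviation of each single agent.\<close>

definition dispersion :: "('n::finite \<Rightarrow> 'b::real_normed_vector) \<Rightarrow> real" where
  "dispersion v = L2_set (\<lambda>i. norm (v i - avg v)) UNIV"

lemma dispersion_nonneg [simp]: "0 \<le> dispersion v"
  by (simp add: dispersion_def L2_set_nonneg)

lemma deviation_le_dispersion: "norm (v i - avg v) \<le> dispersion v"
  unfolding dispersion_def by (rule member_le_L2_set) auto

lemma dispersion_triangle: "dispersion (\<lambda>i. u i + v i) \<le> dispersion u + dispersion v"
proof -
  have "dispersion (\<lambda>i. u i + v i)
      \<le> L2_set (\<lambda>i. norm (u i - avg u) + norm (v i - avg v)) UNIV"
    unfolding dispersion_def avg_add
    by (rule L2_set_mono) (use norm_triangle_ineq in \<open>auto simp: add_diff_add\<close>)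
  also have "\<dots> \<le> dispersion u + dispersion v"
    unfolding dispersion_def by (rule L2_set_triangle_ineq)
  finally show ?thesis .
qed

lemma dispersion_le_radius:
  fixes v :: "'n::finite \<Rightarrow> 'b::real_normed_vector"
  assumes "\<And>i. norm (v i - c) \<le> R"
  shows "dispersion v \<le> real CARD('n) * (2 * R)"
proof -
  have "norm (avg v - c) \<le> R"
    using norm_avg_le_bound[of "\<lambda>i. v i - c" R] assms by (simp add: avg_diff)
  then have "norm (v i - avg v) \<le> 2 * R" for i
    using assms[of i] norm_triangle_ineq4[of "v i - c" "avg v - c"] by simp
  then have "(\<Sum>i\<in>UNIV. norm (v i - avg v)) \<le> (\<Sum>i::'n\<in>UNIV. 2 * R)"
    by (intro sum_mono) auto
  then show ?thesis
    unfolding dispersion_def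
    using L2_set_le_sum[of UNIV "\<lambda>i. norm (v i - avg v)"] by simp
qed

lemma mix_mpow: "mix (mpow W m) v = (mix W ^^ m) v"
proof (induction m)
  case 0
  show ?case
    by (auto simp: mix_def mpow_def mat_def if_distrib[of "\<lambda>x. x *\<^sub>R _"] cong: if_cong)
next
  case (Suc m)
  have "mix (A ** B) v = mix A (mix B v)" for A B :: "real^'a^'a"
    by (rule ext) (simp add: mix_def matrix_matrix_mult_def scaleR_sum_left scaleR_sum_right
        sum.swap[of "\<lambda>i j. _ i j *\<^sub>R v j"])
  then show ?case using Suc by (simp add: mpow_def)
qed

lemma avg_mix:
  assumes "mixing_matrix W"
  shows "avg (mix W v) = avg v"
proof -
  have "(\<Sum>i\<in>UNIV. mix W v i) = (\<Sum>j\<in>UNIV. (\<Sum>i\<in>UNIV. W $ i $ j) *\<^sub>R v j)"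
    unfolding mix_def by (subst sum.swap) (simp add: scaleR_sum_left)
  also have "\<dots> = (\<Sum>j\<in>UNIV. v j)"
    using assms by (simp add: mixing_matrix_def)
  finally show ?thesis by (simp add: avg_def)
qed

lemma avg_mix_mpow:
  assumes "mixing_matrix W"
  shows "avg (mix (mpow W m) v) = avg v"
  unfolding mix_mpow by (induction m) (simp_all add: avg_mix[OF assms])

lemma mixing_rate_nonneg: "0 \<le> mixing_rate W"
  unfolding mixing_rate_def spec_norm_def
  by (rule onorm_pos_le) (simp add: matrix_vector_mul_bounded_linear)

lemma norm_power2_Basis: "(norm (x :: 'b::euclidean_space))\<^sup>2 = (\<Sum>b\<in>Basis. (x \<bullet> b)\<^sup>2)"
  unfolding power2_norm_eq_inner by (subst euclidean_inner) (simp add: power2_eq_square)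

lemma norm_power2_vec: "(norm (x :: real^'n))\<^sup>2 = (\<Sum>i\<in>UNIV. (x $ i)\<^sup>2)"
  unfolding power2_norm_eq_inner by (simp add: inner_vec_def power2_eq_square)

text \<open>The deviations from the average sum to zero, hence the averaging matrix annihilates
  them and \<open>W\<close> acts on them as \<open>W - (1/N) 1 1\<^sup>T\<close>.  For vector-valued data this is applied
  to each coordinate.\<close>

lemma dispersion_mix:
  fixes v :: "'n::finite \<Rightarrow> 'b::euclidean_space"
  assumes W: "mixing_matrix W"
  shows "dispersion (mix W v) \<le> mixing_rate W * dispersion v"
proof -
  define J :: "real^'n^'n" where "J = (\<chi> i j. 1 / real CARD('n))"
  define z where "z b = (\<chi> i. (v i - avg v) \<bullet> b)" for b :: 'b
  have row: "(\<Sum>j\<in>UNIV. W $ i $ j) = 1" for i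
    using W by (simp add: mixing_matrix_def)
  have comp: "(mix W v i - avg v) \<bullet> b = ((W - J) *v z b) $ i" for i b
  proof -
    have "(\<Sum>j\<in>UNIV. z b $ j) = 0"
    proof -
      have "avg (\<lambda>j. v j - avg v) = 0" by (simp add: avg_diff)
      then have "(\<Sum>j\<in>UNIV. v j - avg v) = 0"
        unfolding avg_def[of "\<lambda>j. v j - avg v"] by simp
      then have "(\<Sum>j\<in>UNIV. v j - avg v) \<bullet> b = 0" by simp
      then show ?thesis by (simp only: z_def inner_sum_left vec_lambda_beta)
    qed
    then have "(J *v z b) $ i = 0"
      by (simp add: J_def matrix_vector_mult_def flip: sum_divide_distrib)
    moreover have "mix W v i - avg v = (\<Sum>j\<in>UNIV. (W $ i $ j) *\<^sub>R (v j - avg v))"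
      using row[of i] by (simp add: mix_def scaleR_diff_right sum_subtractf flip: scaleR_sum_left)
    then have "(mix W v i - avg v) \<bullet> b = (W *v z b) $ i"
      by (simp add: inner_sum_left matrix_vector_mult_def z_def)
    ultimately show ?thesis by (simp add: matrix_vector_mult_diff_rdistrib)
  qed
  have contr: "norm ((W - J) *v z b) \<le> mixing_rate W * norm (z b)" for b
    unfolding mixing_rate_def spec_norm_def J_def
    by (rule onorm) (simp add: matrix_vector_mul_bounded_linear)
  have "(\<Sum>i\<in>UNIV. (norm (mix W v i - avg v))\<^sup>2)
      = (\<Sum>b\<in>Basis. (norm ((W - J) *v z b))\<^sup>2)"
  proof -
    have "(\<Sum>i\<in>UNIV. (norm (mix W v i - avg v))\<^sup>2)
        = (\<Sum>i\<in>UNIV. \<Sum>b\<in>Basis. (((W - J) *v z b) $ i)\<^sup>2)"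
      by (simp add: norm_power2_Basis flip: comp)
    also have "\<dots> = (\<Sum>b\<in>Basis. \<Sum>i\<in>UNIV. (((W - J) *v z b) $ i)\<^sup>2)"
      by (rule sum.swap)
    finally show ?thesis by (simp add: norm_power2_vec)
  qed
  also have "\<dots> \<le> (\<Sum>b\<in>Basis. (mixing_rate W)\<^sup>2 * (norm (z b))\<^sup>2)"
    by (intro sum_mono) (metis contr norm_ge_zero power_mono power_mult_distrib)
  also have "\<dots> = (mixing_rate W)\<^sup>2 * (\<Sum>i\<in>UNIV. (norm (v i - avg v))\<^sup>2)"
  proof -
    have "(\<Sum>b\<in>Basis. (norm (z b))\<^sup>2) = (\<Sum>b\<in>Basis. \<Sum>i\<in>UNIV. ((v i - avg v) \<bullet> b)\<^sup>2)"
      by (simp add: norm_power2_vec z_def)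
    also have "\<dots> = (\<Sum>i\<in>UNIV. \<Sum>b\<in>Basis. ((v i - avg v) \<bullet> b)\<^sup>2)"
      by (rule sum.swap)
    also have "\<dots> = (\<Sum>i\<in>UNIV. (norm (v i - avg v))\<^sup>2)"
      by (simp add: norm_power2_Basis)
    finally show ?thesis by (simp flip: sum_distrib_left)
  qed
  finally have "(dispersion (mix W v))\<^sup>2 \<le> (mixing_rate W * dispersion v)\<^sup>2"
    unfolding dispersion_def L2_set_def avg_mix[OF W]
    by (simp add: sum_nonneg power_mult_distrib)
  then show ?thesis
    by (rule power2_le_imp_le) (simp add: mixing_rate_nonneg)
qed

lemma dispersion_mix_mpow:
  fixes v :: "'n::finite \<Rightarrow> 'b::euclidean_space"
  assumes W: "mixing_matrix W"
  shows "dispersion (mix (mpow W m) v) \<le> mixing_rate W ^ m * dispersion v"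
  unfolding mix_mpow
proof (induction m)
  case (Suc m)
  show ?case
    using dispersion_mix[OF W, of "(mix W ^^ m) v"]
      mult_left_mono[OF Suc mixing_rate_nonneg[of W]] by simp
qed simp

section \<open>Symmetric matrices, the least eigenvalue and the spectral norm\<close>

lemma norm_matrix_vector_le_spec_norm: "norm (A *v x) \<le> spec_norm A * norm x"
  unfolding spec_norm_def by (rule onorm) (rule matrix_vector_mul_bounded_linear)

lemma spec_norm_leI: "(\<And>x. norm (A *v x) \<le> c * norm x) \<Longrightarrow> spec_norm A \<le> c"
  unfolding spec_norm_def by (rule onorm_le)

lemma spec_norm_nonneg: "0 \<le> spec_norm A"
  unfolding spec_norm_def by (rule onorm_pos_le) (rule matrix_vector_mul_bounded_linear)

lemma spec_norm_le_norm: "spec_norm (A :: real^'d^'d) \<le> norm A"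
proof (rule spec_norm_leI)
  fix x :: "real^'d"
  have "norm (A *v x) \<le> L2_set (\<lambda>i. norm (A $ i) * norm x) UNIV"
    unfolding norm_vec_def[of "A *v x"]
    by (rule L2_set_mono) (use Cauchy_Schwarz_ineq2 in \<open>auto simp: matrix_vector_mul_component\<close>)
  also have "\<dots> = norm A * norm x"
    by (simp add: norm_vec_def[of A] L2_set_left_distrib)
  finally show "norm (A *v x) \<le> norm A * norm x" .
qed

lemma norm_le_spec_norm:
  "norm (A :: real^'d^'d) \<le> (real CARD('d))\<^sup>2 * spec_norm A"
proof -
  have "norm A \<le> (\<Sum>i\<in>UNIV. \<Sum>j\<in>UNIV. \<bar>A $ i $ j\<bar>)"
    unfolding norm_vec_def[of A]
    by (rule order_trans[OF L2_set_le_sum]) (auto intro!: sum_mono norm_le_l1_cart)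
  also have "\<dots> \<le> (\<Sum>i::'d\<in>UNIV. \<Sum>j::'d\<in>UNIV. spec_norm A)"
    unfolding spec_norm_def by (intro sum_mono matrix_component_le_onorm)
  finally show ?thesis by (simp add: power2_eq_square)
qed

lemma symmetric_matrix_iff:
  fixes A :: "real^'d^'d"
  shows "transpose A = A \<longleftrightarrow> (\<forall>u v. (A *v u) \<bullet> v = u \<bullet> (A *v v))"
proof -
  have *: "(transpose A *v u) \<bullet> v = u \<bullet> (A *v v)" for u v
    unfolding transpose_matrix_vector dot_lmul_matrix ..
  show ?thesis
  proof
    assume sym: "\<forall>u v. (A *v u) \<bullet> v = u \<bullet> (A *v v)"
    have "transpose A *v u = A *v u" for u
    proof -
      have "\<forall>v. (transpose A *v u) \<bullet> v = (A *v u) \<bullet> v"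
        unfolding * using sym by metis
      then show ?thesis unfolding vector_eq_rdot .
    qed
    then show "transpose A = A" unfolding matrix_eq by blast
  next
    assume "transpose A = A"
    then show "\<forall>u v. (A *v u) \<bullet> v = u \<bullet> (A *v v)" using * by metis
  qed
qed

text \<open>The minimum \<open>m\<close> of \<open>v \<bullet> A v\<close> over the unit sphere is attained at some \<open>v\<close>.  Since
  \<open>w \<bullet> A w - m (w \<bullet> w)\<close> is nonnegative and vanishes at \<open>v\<close>, its derivative at \<open>v\<close> in every
  direction vanishes, so \<open>v\<close> is an eigenvector for \<open>m\<close>; no eigenvalue is smaller.\<close>

lemma lambda_min_Rayleigh:
  fixes A :: "real^'d^'d"
  assumes sym: "transpose A = A"
  shows "\<exists>v. norm v = 1 \<and> v \<bullet> (A *v v) = lambda_min A"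
    and "lambda_min A * (w \<bullet> w) \<le> w \<bullet> (A *v w)"
proof -
  have cont: "continuous_on (sphere (0::real^'d) 1) (\<lambda>v. v \<bullet> (A *v v))"
    by (intro continuous_intros linear_continuous_on matrix_vector_mul_bounded_linear)
  obtain v0 where v0: "norm v0 = 1"
    and min: "\<And>v. norm v = 1 \<Longrightarrow> v0 \<bullet> (A *v v0) \<le> v \<bullet> (A *v v)"
  proof -
    have "sphere (0::real^'d) 1 \<noteq> {}" by simp
    then show ?thesis
      using continuous_attains_inf[OF compact_sphere _ cont] that by (auto simp: sphere_def)
  qed
  define m where "m = v0 \<bullet> (A *v v0)"
  have ge: "m * (v \<bullet> v) \<le> v \<bullet> (A *v v)" for v
  proof (cases "v = 0")
    case False
    have "m \<le> sgn v \<bullet> (A *v sgn v)"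
      unfolding m_def by (rule min) (simp add: norm_sgn False)
    also have "\<dots> = (v \<bullet> (A *v v)) / (norm v)\<^sup>2"
      by (simp add: sgn_div_norm matrix_vector_mult_scaleR divide_simps power2_eq_square)
    finally show ?thesis
      using False by (simp add: field_simps dot_square_norm)
  qed simp
  have eig: "A *v v0 = m *\<^sub>R v0"
  proof -
    define z where "z = A *v v0 - m *\<^sub>R v0"
    define q where "q v = v \<bullet> (A *v v) - m * (v \<bullet> v)" for v
    have expand: "q (v0 + t *\<^sub>R z) = 2 * t * (z \<bullet> z) + t\<^sup>2 * q z" for t
    proof -
      have s: "v0 \<bullet> (A *v z) = z \<bullet> (A *v v0)"
        using sym unfolding symmetric_matrix_iff by (simp add: inner_commute)
      have "q v0 = 0"
        using v0 by (simp add: q_def m_def norm_eq_1)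
      moreover have "q (v0 + t *\<^sub>R z)
          = q v0 + 2 * t * (z \<bullet> (A *v v0) - m * (z \<bullet> v0)) + t\<^sup>2 * q z"
        unfolding q_def
        by (simp add: matrix_vector_right_distrib matrix_vector_mult_scaleR inner_add_left
            inner_add_right s inner_commute[of v0 z] power2_eq_square distrib_left right_diff_distrib)
      ultimately show ?thesis by (simp add: z_def inner_simps)
    qed
    (* Otherwise a small step from v0 against z would make q negative. *)
    have "z \<bullet> z = 0"
    proof (rule ccontr)
      assume "z \<bullet> z \<noteq> 0"
      then have pos: "0 < z \<bullet> z" by (simp add: less_le)
      have qz: "0 \<le> q z" using ge by (simp add: q_def)
      define t where "t = - (z \<bullet> z) / (q z + 1)"
      have "t < 0" unfolding t_def using pos qz by (simp add: divide_neg_pos)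
      moreover have "t * q z > - 2 * (z \<bullet> z)"
      proof -
        have "t * q z = - (z \<bullet> z) * (q z / (q z + 1))" by (simp add: t_def)
        moreover have "q z / (q z + 1) < 1" using qz by simp
        ultimately have "t * q z > - (z \<bullet> z)"
          using pos mult_strict_left_mono[of "q z / (q z + 1)" 1 "z \<bullet> z"] by simp
        then show ?thesis using pos by linarith
      qed
      ultimately have "t * (2 * (z \<bullet> z) + t * q z) < 0"
        by (intro mult_neg_pos) auto
      then have "q (v0 + t *\<^sub>R z) < 0"
        unfolding expand by (simp add: power2_eq_square algebra_simps)
      then show False using ge[of "v0 + t *\<^sub>R z"] by (simp add: q_def)
    qed
    then show ?thesis by (simp add: z_def)
  qed
  have "lambda_min A = m"
    unfolding lambda_min_def
  proof (rule Least_equality)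
    show "\<exists>v. v \<noteq> 0 \<and> A *v v = m *\<^sub>R v"
      using eig v0 by (intro exI[of _ v0]) auto
  next
    fix c assume "\<exists>v. v \<noteq> 0 \<and> A *v v = c *\<^sub>R v"
    then obtain v where "v \<noteq> 0" "A *v v = c *\<^sub>R v" by blast
    then show "m \<le> c" using ge[of v] by (simp add: inner_gt_zero_iff)
  qed
  then show "\<exists>v. norm v = 1 \<and> v \<bullet> (A *v v) = lambda_min A"
    and "lambda_min A * (w \<bullet> w) \<le> w \<bullet> (A *v w)"
    using v0 ge by (auto simp: m_def)
qed

text \<open>Cauchy-Schwarz applied to \<open>v \<bullet> (B + c I) v\<close>, which is at least \<open>c\<close> times the squared
  norm of \<open>v\<close>.  It controls every regularised Newton step.\<close>

lemma shifted_matrix_lower_bound: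
  fixes B :: "real^'d^'d"
  assumes "\<And>v. 0 \<le> v \<bullet> (B *v v)"
  shows "c * norm v \<le> norm ((B + c *\<^sub>R mat 1) *v v)"
proof (cases "v = 0")
  case False
  have "c * norm v * norm v \<le> v \<bullet> ((B + c *\<^sub>R mat 1) *v v)"
    using assms[of v]
    by (simp add: matrix_vector_mult_add_rdistrib inner_simps dot_square_norm
        power2_eq_square scaleR_matrix_vector_assoc[symmetric])
  also have "\<dots> \<le> norm ((B + c *\<^sub>R mat 1) *v v) * norm v"
    using norm_cauchy_schwarz[of v "(B + c *\<^sub>R mat 1) *v v"] by (simp add: mult.commute)
  finally show ?thesis using False by simp
qed simp

lemma invertible_shifted_matrix:
  fixes B :: "real^'d^'d"
  assumes psd: "\<And>v. 0 \<le> v \<bullet> (B *v v)" and "0 < c"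
  shows "invertible (B + c *\<^sub>R mat 1)"
proof -
  have "v = 0" if "(B + c *\<^sub>R mat 1) *v v = 0" for v
    using shifted_matrix_lower_bound[OF psd, of c v] that \<open>0 < c\<close>
    by (simp add: mult_le_0_iff)
  then show ?thesis
    by (simp add: invertible_left_inverse matrix_left_invertible_ker)
qed

section \<open>Convex functions with Lipschitz gradient and Hessian\<close>

lemma grad_eqI:
  assumes "GDERIV h x :> v"
  shows "grad h x = v"
  unfolding grad_def
proof (rule the_equality)
  show "GDERIV h x :> v" by (rule assms)
next
  fix w assume "GDERIV h x :> w"
  then have "(\<lambda>u. u \<bullet> w) = (\<lambda>u. u \<bullet> v)"
    using assms has_derivative_unique unfolding gderiv_def by blast
  then show "w = v" by (metis vector_eq_ldot)
qed

lemma GDERIV_grad: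
  fixes h :: "real^'d \<Rightarrow> real"
  assumes "h differentiable at x"
  shows "GDERIV h x :> grad h x"
proof -
  obtain T where T: "(h has_derivative T) (at x)"
    using assms by (auto simp: differentiable_def)
  have "T = (\<lambda>u. u \<bullet> adjoint T 1)"
    using adjoint_works[of T _ 1] has_derivative_linear[OF T] by (auto simp: fun_eq_iff)
  then have "GDERIV h x :> adjoint T 1"
    using T unfolding gderiv_def by metis
  then show ?thesis using grad_eqI by metis
qed

locale smooth_convex_function =
  fixes h :: "real^'d \<Rightarrow> real" and L1 L2 :: real
  assumes convex: "convex_on UNIV h"
    and smooth: "twice_cont_diff h"
    and grad_Lipschitz: "norm (grad h x - grad h y) \<le> L1 * norm (x - y)"
    and hess_Lipschitz: "spec_norm (hess h x - hess h y) \<le> L2 * norm (x - y)"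
begin

lemma GDERIV_h: "GDERIV h x :> grad h x"
  using smooth GDERIV_grad by (auto simp: twice_cont_diff_def)

lemma grad_has_derivative: "(grad h has_derivative (\<lambda>v. hess h x *v v)) (at x)"
  using smooth unfolding hess_def twice_cont_diff_def by (auto simp flip: jacobian_works)

lemma line_has_derivative:
  "((\<lambda>t. h (x + t *\<^sub>R v)) has_real_derivative grad h (x + t *\<^sub>R v) \<bullet> v) (at t within A)"
proof -
  have "((\<lambda>t. h (x + t *\<^sub>R v)) has_derivative (\<lambda>s. (s *\<^sub>R v) \<bullet> grad h (x + t *\<^sub>R v))) (at t)"
    by (rule has_derivative_compose[where g = h, OF _ GDERIV_h[unfolded gderiv_def]])
      (auto intro!: derivative_eq_intros)
  then have "((\<lambda>t. h (x + t *\<^sub>R v)) has_real_derivative grad h (x + t *\<^sub>R v) \<bullet> v) (at t)"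
    unfolding has_field_derivative_def by (rule has_derivative_eq_rhs) (simp add: inner_commute fun_eq_iff)
  then show ?thesis by (rule has_field_derivative_at_within)
qed

lemma grad_line_has_derivative:
  "((\<lambda>t. grad h (x + t *\<^sub>R v)) has_derivative (\<lambda>s. s *\<^sub>R (hess h (x + t *\<^sub>R v) *v v)))
     (at t within A)"
proof -
  have "((\<lambda>t. grad h (x + t *\<^sub>R v)) has_derivative (\<lambda>s. hess h (x + t *\<^sub>R v) *v (s *\<^sub>R v))) (at t)"
    by (rule has_derivative_compose[where g = "grad h", OF _ grad_has_derivative])
      (auto intro!: derivative_eq_intros)
  then show ?thesis
    by (simp add: matrix_vector_mult_scaleR has_derivative_at_withinI)
qed

lemma above_tangent: "h x + grad h x \<bullet> (y - x) \<le> h y"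
proof -
  define \<phi> where "\<phi> t = h (x + t *\<^sub>R (y - x))" for t
  have "convex_on UNIV \<phi>"
  proof (rule convex_onI)
    fix t a b :: real assume t: "0 < t" "t < 1"
    have "x + ((1 - t) * a + t * b) *\<^sub>R (y - x)
        = (1 - t) *\<^sub>R (x + a *\<^sub>R (y - x)) + t *\<^sub>R (x + b *\<^sub>R (y - x))"
      by (simp add: algebra_simps)
    then show "\<phi> ((1 - t) *\<^sub>R a + t *\<^sub>R b) \<le> (1 - t) * \<phi> a + t * \<phi> b"
      unfolding \<phi>_def using convex_onD[OF convex, of t] t by simp
  qed simp
  moreover have "(\<phi> has_real_derivative grad h x \<bullet> (y - x)) (at 0 within UNIV)"
    using line_has_derivative[of x "y - x" 0 UNIV] by (simp add: \<phi>_def[abs_def])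
  ultimately have "\<phi> 1 - \<phi> 0 \<ge> (grad h x \<bullet> (y - x)) * (1 - 0)"
    by (intro convex_on_imp_above_tangent[of UNIV]) auto
  then show ?thesis by (simp add: \<phi>_def)
qed

lemma grad_monotone: "0 \<le> (grad h y - grad h x) \<bullet> (y - x)"
  using above_tangent[of x y] above_tangent[of y x] by (simp add: inner_simps algebra_simps)

text \<open>This bound and the next one on the Hessian hold because a suitable function of one
  variable, built from the gradient along a line, is nondecreasing.\<close>

lemma hess_psd: "0 \<le> v \<bullet> (hess h x *v v)"
proof -
  let ?\<psi> = "\<lambda>t. grad h (x + t *\<^sub>R v) \<bullet> v"
  have "mono_on UNIV ?\<psi>"
  proof (rule mono_onI)
    fix a b :: real assume "a \<le> b"
    show "?\<psi> a \<le> ?\<psi> b"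
    proof (cases "a = b")
      case False
      have "0 \<le> (grad h (x + b *\<^sub>R v) - grad h (x + a *\<^sub>R v)) \<bullet> ((b - a) *\<^sub>R v)"
        using grad_monotone[of "x + b *\<^sub>R v" "x + a *\<^sub>R v"] by (simp add: algebra_simps)
      then show ?thesis
        using False \<open>a \<le> b\<close> by (simp add: zero_le_mult_iff inner_simps)
    qed simp
  qed
  moreover have "(?\<psi> has_real_derivative (hess h x *v v) \<bullet> v) (at 0)"
    using has_derivative_inner_left[OF grad_line_has_derivative[of x v 0 UNIV], of v]
    unfolding has_field_derivative_def
    by (rule has_derivative_eq_rhs) (simp add: fun_eq_iff)
  ultimately have "0 \<le> (hess h x *v v) \<bullet> v"
    by (rule mono_on_imp_deriv_nonneg) simp
  then show ?thesis by (simp add: inner_commute)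
qed

lemma spec_norm_hess_le: "spec_norm (hess h x) \<le> L1"
proof (rule spec_norm_leI)
  fix v
  define z where "z = hess h x *v v"
  let ?\<psi> = "\<lambda>t. L1 * norm v * norm z * t - grad h (x + t *\<^sub>R v) \<bullet> z"
  have "mono_on UNIV ?\<psi>"
  proof (rule mono_onI)
    fix a b :: real assume "a \<le> b"
    have "(grad h (x + b *\<^sub>R v) - grad h (x + a *\<^sub>R v)) \<bullet> z
        \<le> norm (grad h (x + b *\<^sub>R v) - grad h (x + a *\<^sub>R v)) * norm z"
      by (rule norm_cauchy_schwarz)
    also have "\<dots> \<le> L1 * norm ((x + b *\<^sub>R v) - (x + a *\<^sub>R v)) * norm z"
      by (intro mult_right_mono grad_Lipschitz norm_ge_zero)
    also have "(x + b *\<^sub>R v) - (x + a *\<^sub>R v) = (b - a) *\<^sub>R v"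
      by (simp add: scaleR_diff_left)
    also have "norm ((b - a) *\<^sub>R v) = (b - a) * norm v"
      using \<open>a \<le> b\<close> by simp
    finally show "?\<psi> a \<le> ?\<psi> b"
      by (simp add: inner_diff_left algebra_simps)
  qed
  moreover have "(?\<psi> has_real_derivative L1 * norm v * norm z - z \<bullet> z) (at 0)"
  proof -
    have "((\<lambda>t. grad h (x + t *\<^sub>R v) \<bullet> z) has_real_derivative z \<bullet> z) (at 0)"
      using has_derivative_inner_left[OF grad_line_has_derivative[of x v 0 UNIV], of z]
      unfolding has_field_derivative_def
      by (rule has_derivative_eq_rhs) (simp add: fun_eq_iff z_def)
    then show ?thesis by (auto intro!: derivative_eq_intros)
  qed
  ultimately have "0 \<le> L1 * norm v * norm z - z \<bullet> z"
    by (rule mono_on_imp_deriv_nonneg) simp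
  then have "norm z * norm z \<le> L1 * norm v * norm z"
    by (simp add: dot_square_norm power2_eq_square)
  moreover have "0 \<le> L1 * norm v"
    using grad_Lipschitz[of v 0] norm_ge_zero by (metis diff_zero order_trans)
  ultimately show "norm (hess h x *v v) \<le> L1 * norm v"
    by (cases "z = 0") (auto simp: z_def)
qed

text \<open>The factor \<open>1/2\<close> matters: with it the remainder of a step is at most half of the
  regularisation times the step length, which leaves a definite decrease even for
  \<open>M = L2\<close>.\<close>

lemma grad_Taylor:
  "norm (grad h (x + s) - grad h x - hess h x *v s) \<le> L2 / 2 * (norm s)\<^sup>2"
proof -
  define \<phi> where "\<phi> t = grad h (x + t *\<^sub>R s) - t *\<^sub>R (hess h x *v s)" for t :: real
  let ?\<phi>' = "\<lambda>t. hess h (x + t *\<^sub>R s) *v s - hess h x *v s"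
  have "norm (\<phi> 1 - \<phi> 0) \<le> L2 / 2 * (norm s)\<^sup>2 * 1\<^sup>2 - L2 / 2 * (norm s)\<^sup>2 * 0\<^sup>2"
  proof (rule differentiable_bound_general[where f' = ?\<phi>'
        and \<phi> = "\<lambda>t. L2 / 2 * (norm s)\<^sup>2 * t\<^sup>2" and \<phi>' = "\<lambda>t. L2 * (norm s)\<^sup>2 * t"])
    have d: "(\<phi> has_vector_derivative ?\<phi>' t) (at t within A)" for t A
      unfolding \<phi>_def[abs_def] has_vector_derivative_def
      by (rule derivative_eq_intros grad_line_has_derivative refl)+ (simp add: scaleR_diff_right)
    show "(\<phi> has_vector_derivative ?\<phi>' t) (at t)" for t by (rule d)
    show "continuous_on {0..1} \<phi>"
      using d by (intro continuous_on_vector_derivative)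
    fix t :: real assume t: "0 < t" "t < 1"
    show "((\<lambda>t. L2 / 2 * (norm s)\<^sup>2 * t\<^sup>2) has_vector_derivative L2 * (norm s)\<^sup>2 * t) (at t)"
      unfolding has_real_derivative_iff_has_vector_derivative[symmetric]
      by (auto intro!: derivative_eq_intros)
    have "norm (?\<phi>' t) \<le> spec_norm (hess h (x + t *\<^sub>R s) - hess h x) * norm s"
      using norm_matrix_vector_le_spec_norm by (metis matrix_vector_mult_diff_rdistrib)
    also have "\<dots> \<le> L2 * norm (t *\<^sub>R s) * norm s"
      using hess_Lipschitz[of "x + t *\<^sub>R s" x] by (intro mult_right_mono) auto
    finally show "norm (?\<phi>' t) \<le> L2 * (norm s)\<^sup>2 * t"
      using t by (simp add: power2_eq_square ac_simps)
  qed (auto intro!: continuous_intros)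
  then show ?thesis by (simp add: \<phi>_def algebra_simps)
qed

text \<open>The mixed second difference of \<open>h\<close> along \<open>u\<close> and \<open>v\<close> is \<open>t\<^sup>2 (H u \<bullet> v) + O(t\<^sup>3)\<close>; as it
  is symmetric in \<open>u\<close> and \<open>v\<close>, so is its leading coefficient.\<close>

lemma second_difference:
  assumes "0 < t"
  shows "\<bar>h (x + t *\<^sub>R u + t *\<^sub>R v) - h (x + t *\<^sub>R u) - h (x + t *\<^sub>R v) + h x
      - t\<^sup>2 * ((hess h x *v u) \<bullet> v)\<bar> \<le> t ^ 3 * (L2 * (norm u + norm v) ^ 3)"
proof -
  have L2: "0 \<le> L2 * norm w" for w :: "real^'d"
    using hess_Lipschitz[of w 0] spec_norm_nonneg by (metis diff_zero order_trans)
  have "0 \<le> L2"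
    using L2[of "axis undefined 1"] by (simp add: norm_axis_1)
  define \<phi> where "\<phi> \<tau> = h ((x + t *\<^sub>R u) + \<tau> *\<^sub>R v) - h (x + \<tau> *\<^sub>R v)" for \<tau>
  let ?\<phi>' = "\<lambda>\<tau>. (grad h (x + t *\<^sub>R u + \<tau> *\<^sub>R v) - grad h (x + \<tau> *\<^sub>R v)) \<bullet> v"
  have "(\<phi> has_real_derivative ?\<phi>' \<tau>) (at \<tau>)" for \<tau>
    unfolding \<phi>_def[abs_def] inner_diff_left
    by (intro DERIV_diff line_has_derivative)
  then obtain \<tau> where \<tau>: "0 < \<tau>" "\<tau> < t" "\<phi> t - \<phi> 0 = t * ?\<phi>' \<tau>"
    using MVT2[of 0 t \<phi> ?\<phi>'] assms by auto
  let ?N = "norm u + norm v"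
  define e where "e s = grad h (x + s) - grad h x - hess h x *v s" for s
  have e: "norm (e s) \<le> L2 / 2 * (t * ?N)\<^sup>2" if "norm s \<le> t * ?N" for s
    unfolding e_def
    by (rule order_trans[OF grad_Taylor]) (intro mult_left_mono power_mono that, use \<open>0 \<le> L2\<close> in auto)
  have s1: "norm (t *\<^sub>R u + \<tau> *\<^sub>R v) \<le> t * ?N"
    by (rule order_trans[OF norm_triangle_ineq])
      (use \<tau> in \<open>auto simp: distrib_left intro!: mult_right_mono\<close>)
  have s2: "norm (\<tau> *\<^sub>R v) \<le> t * ?N"
    using \<tau> by (auto intro!: mult_mono)
  have "grad h (x + t *\<^sub>R u + \<tau> *\<^sub>R v) - grad h (x + \<tau> *\<^sub>R v) - t *\<^sub>R (hess h x *v u)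
      = e (t *\<^sub>R u + \<tau> *\<^sub>R v) - e (\<tau> *\<^sub>R v)"
    by (simp add: e_def matrix_vector_right_distrib matrix_vector_mult_scaleR algebra_simps)
  moreover have "norm (e (t *\<^sub>R u + \<tau> *\<^sub>R v) - e (\<tau> *\<^sub>R v)) \<le> L2 * (t * ?N)\<^sup>2"
    using norm_triangle_ineq4[of "e (t *\<^sub>R u + \<tau> *\<^sub>R v)" "e (\<tau> *\<^sub>R v)"] e[OF s1] e[OF s2] by linarith
  ultimately have d: "norm (grad h (x + t *\<^sub>R u + \<tau> *\<^sub>R v) - grad h (x + \<tau> *\<^sub>R v)
      - t *\<^sub>R (hess h x *v u)) \<le> L2 * (t * ?N)\<^sup>2" by simp
  have "\<bar>?\<phi>' \<tau> - t * ((hess h x *v u) \<bullet> v)\<bar> \<le> L2 * (t * ?N)\<^sup>2 * norm v"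
    using order_trans[OF Cauchy_Schwarz_ineq2 mult_right_mono[OF d norm_ge_zero[of v]]]
    by (simp add: inner_simps)
  also have "\<dots> \<le> L2 * (t * ?N)\<^sup>2 * ?N"
    using \<open>0 \<le> L2\<close> by (intro mult_left_mono) auto
  finally have "t * \<bar>?\<phi>' \<tau> - t * ((hess h x *v u) \<bullet> v)\<bar> \<le> t * (L2 * (t * ?N)\<^sup>2 * ?N)"
    using assms by (intro mult_left_mono) auto
  moreover have "t * \<bar>?\<phi>' \<tau> - t * ((hess h x *v u) \<bullet> v)\<bar> = \<bar>\<phi> t - \<phi> 0 - t\<^sup>2 * ((hess h x *v u) \<bullet> v)\<bar>"
    using assms \<tau>(3) by (simp add: abs_mult_pos' power2_eq_square right_diff_distrib)
  ultimately show ?thesis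
    by (simp add: \<phi>_def power2_eq_square power3_eq_cube algebra_simps)
qed

lemma hess_symmetric: "transpose (hess h x) = hess h x"
  unfolding symmetric_matrix_iff
proof (intro allI)
  fix u v :: "real^'d"
  let ?C = "L2 * (norm u + norm v) ^ 3"
  let ?a = "\<bar>(hess h x *v u) \<bullet> v - (hess h x *v v) \<bullet> u\<bar>"
  have "?a \<le> t * (2 * ?C)" if "0 < t" for t
  proof -
    have "t\<^sup>2 * ?a = \<bar>t\<^sup>2 * ((hess h x *v u) \<bullet> v) - t\<^sup>2 * ((hess h x *v v) \<bullet> u)\<bar>"
      by (simp add: abs_mult flip: right_diff_distrib)
    also have "\<dots> \<le> 2 * (t ^ 3 * ?C)"
      using second_difference[OF that, of x u v] second_difference[OF that, of x v u]
      by (simp add: add.commute add.left_commute abs_le_iff)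
    finally have "t\<^sup>2 * ?a \<le> t\<^sup>2 * (t * (2 * ?C))"
      by (simp add: power2_eq_square power3_eq_cube algebra_simps)
    then show ?thesis using that by simp
  qed
  then have "eventually (\<lambda>t. ?a \<le> t * (2 * ?C)) (at_right 0)"
    by (simp add: eventually_at_right_less eventually_mono[OF eventually_at_right_less])
  moreover have "((\<lambda>t. t * (2 * ?C)) \<longlongrightarrow> 0 * (2 * ?C)) (at_right 0)"
    by (intro tendsto_intros)
  ultimately have "?a \<le> 0 * (2 * ?C)"
    by (intro tendsto_lowerbound[of _ _ "at_right 0" ?a]) auto
  then show "(hess h x *v u) \<bullet> v = u \<bullet> (hess h x *v v)"
    by (simp add: inner_commute)
qed

end

section \<open>Consensus and tracking along a run\<close>

text \<open>Since \<open>p\<close> is at least 3, mixing in iteration \<open>k\<close> contracts dispersions by the factor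
  \<open>decay (Suc k)\<close>.  Dispersions of iterates turn out to be \<open>O(decay k)\<close>, those of the mixed
  trackers \<open>O((decay k)\<^sup>2)\<close>.\<close>

definition decay :: "nat \<Rightarrow> real" where
  "decay k = 1 / (real k + 1) ^ 3"

lemma decay_pos: "0 < decay k" and decay_le_1: "decay k \<le> 1"
  by (simp_all add: decay_def)

lemma decay_nonneg: "0 \<le> decay k"
  using decay_pos less_imp_le by blast

lemma decay_antimono: "k \<le> l \<Longrightarrow> decay l \<le> decay k"
  unfolding decay_def by (intro divide_left_mono power_mono mult_pos_pos zero_less_power) auto

lemma decay_Suc_le: "decay (Suc k) \<le> 1 / 8"
  using decay_antimono[of 1 "Suc k"] by (simp add: decay_def)

text \<open>Here \<open>a\<close> and \<open>m\<close> are the dispersions of a tracker before and after its first mixing,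
  and \<open>b\<close> bounds that of the increment added between the two mixings.  The dispersion is
  reset at every iteration to a bounded quantity times the contraction factor, so the two
  mixings that separate successive values of \<open>m\<close> multiply their factors.\<close>

lemma tracker_decay:
  fixes a m :: "nat \<Rightarrow> real"
  assumes m: "\<And>k. m k \<le> decay (Suc k) * a k"
    and a: "\<And>k. a (Suc k) \<le> decay (Suc k) * (m k + b)"
    and nonneg: "\<And>k. 0 \<le> a k" "0 \<le> b"
  shows "m k \<le> 2 * (a 0 + b) * (decay k)\<^sup>2"
proof -
  define B where "B = a 0 + b"
  have B: "0 \<le> B" "b \<le> B" using nonneg by (auto simp: B_def)
  have le: "decay (Suc k) * c \<le> c / 8" if "0 \<le> c" for c k
    using mult_right_mono[OF decay_Suc_le that, of k] by simp
  have scale: "decay (Suc k) * x \<le> decay (Suc k) * y" if "x \<le> y" for k x y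
    using that by (intro mult_left_mono decay_nonneg)
  have m_le: "m k \<le> B" if "a k \<le> B" for k
    using m[of k] le[OF nonneg(1), of k k] that B nonneg(1)[of k] by linarith
  have a_le: "a k \<le> B \<and> a (Suc k) \<le> decay (Suc k) * (2 * B)" for k
  proof (induction k)
    case 0
    have "a 0 \<le> B" using nonneg by (simp add: B_def)
    then have "m 0 + b \<le> 2 * B" using m_le[of 0] B by simp
    then show ?case
      using \<open>a 0 \<le> B\<close> order_trans[OF a scale] by blast
  next
    case (Suc k)
    then have *: "a (Suc k) \<le> B" using le[of "2 * B" k] B by simp
    then have "m (Suc k) + b \<le> 2 * B" using m_le[of "Suc k"] B by simp
    then show ?case
      using * order_trans[OF a scale] by blast
  qed
  show ?thesis
  proof (cases k)
    case 0
    have "m 0 \<le> B" using m_le a_le by blast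
    then show ?thesis using 0 B by (simp add: decay_def B_def)
  next
    case (Suc l)
    have "m k \<le> decay (Suc k) * (decay k * (2 * B))"
      using order_trans[OF m scale] a_le[of l] Suc by blast
    also have "\<dots> \<le> decay k * (decay k * (2 * B))"
      using decay_antimono[of k "Suc k"] decay_pos[of k] B by (intro mult_right_mono) auto
    finally show ?thesis by (simp add: B_def power2_eq_square ac_simps)
  qed
qed

text \<open>The next constants depend only on the problem data and the initial trackers, so that
  they serve for all objectives, networks and runs at once.\<close>

definition mean_gradient_bound where
  "mean_gradient_bound L1 D g0 = avg (\<lambda>i. norm (g0 i)) + 2 * L1 * D"

definition gradient_dispersion_bound where
  "gradient_dispersion_bound L1 D (g0 :: 'n::finite \<Rightarrow> real^'d)
     = 2 * (dispersion g0 + real CARD('n) * (2 * (L1 * (2 * D))))"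

definition hessian_dispersion_bound where
  "hessian_dispersion_bound L2 D (H0 :: 'n::finite \<Rightarrow> real^'d^'d)
     = 2 * (dispersion H0 + real CARD('n) * (2 * ((real CARD('d))\<^sup>2 * (L2 * (2 * D)))))"

definition tracker_bound where
  "tracker_bound L1 D g0 = mean_gradient_bound L1 D g0 + gradient_dispersion_bound L1 D g0"

definition step_bound where
  "step_bound L1 D M g0 = sqrt (tracker_bound L1 D g0 / M)"

definition iterate_dispersion_bound where
  "iterate_dispersion_bound L1 D M (g0 :: 'n::finite \<Rightarrow> real^'d)
     = real CARD('n) * (2 * D) + real CARD('n) * (2 * step_bound L1 D M g0)"

definition run_bound where
  "run_bound L1 L2 D M g0 H0 = 1 + tracker_bound L1 D g0 + hessian_dispersion_bound L2 D H0
     + step_bound L1 D M g0 + iterate_dispersion_bound L1 D M g0"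

locale disgrem_run =
  fixes f :: "'n::finite \<Rightarrow> real^'d::finite \<Rightarrow> real" and W :: "real^'n^'n"
    and r :: "('d, 'n) run" and t :: "nat \<Rightarrow> nat" and L1 L2 D M :: real
  assumes objectives: "smooth_convex f L1 L2"
    and W: "mixing_matrix W"
    and contraction: "mixing_rate W ^ t k \<le> decay (Suc k)"
    and run: "disgrem f W M t t r"
    and bounded: "bounded_iterates f D r"
    and L2_le_M: "L2 \<le> M"
begin

sublocale f: smooth_convex_function "f i" L1 L2 for i
  using objectives by unfold_locales (auto simp: smooth_convex_def)

lemma L1_nonneg: "0 \<le> L1"
  using f.spec_norm_hess_le spec_norm_nonneg order_trans by blast

lemma L2_nonneg: "0 \<le> L2"
proof -
  have "0 \<le> L2 * norm (axis undefined 1 - 0 :: real^'d)"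
    using f.hess_Lipschitz spec_norm_nonneg order_trans by blast
  then show ?thesis by (simp add: norm_axis_1)
qed

lemma M_pos: "0 < M"
  using run by (simp add: disgrem_def)

lemma mX_eq: "mX r k = mix (mpow W (t k)) (X r k)"
  and mG_eq: "mG r k = mix (mpow W (t k)) (G r k)"
  and mH_eq: "mH r k = mix (mpow W (t k)) (H r k)"
  and X_Suc: "X r (Suc k) = mix (mpow W (t k)) (\<lambda>j. mX r k j + S r k j)"
  and G_Suc: "G r (Suc k) = mix (mpow W (t k))
        (\<lambda>j. mG r k j + (grad (f j) (X r (Suc k) j) - grad (f j) (X r k j)))"
  and H_Suc: "H r (Suc k) = mix (mpow W (t k))
        (\<lambda>j. mH r k j + (hess (f j) (X r (Suc k) j) - hess (f j) (X r k j)))"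
  using run unfolding disgrem_def by (auto simp: fun_eq_iff add_diff_eq)

lemma G_0: "G r 0 = (\<lambda>i. grad (f i) (X r 0 i))" and H_0: "H r 0 = (\<lambda>i. hess (f i) (X r 0 i))"
  using run by (auto simp: disgrem_def fun_eq_iff)

lemma step_rule: "if mG r k i = 0 then S r k i = 0
    else (mH r k i + (lam M r k i + del r k i) *\<^sub>R mat 1) *v S r k i = - mG r k i"
  using run unfolding disgrem_def by blast

lemma step_equation: "(mH r k i + (lam M r k i + del r k i) *\<^sub>R mat 1) *v S r k i = - mG r k i"
proof (cases "mG r k i = 0")
  case True
  then have "S r k i = 0" using step_rule[of k i] by simp
  then show ?thesis using True by simp
next
  case False
  then show ?thesis using step_rule[of k i] by simp
qed

subsection \<open>Conserved averages\<close>

lemmas avg_mixed = avg_mix_mpow[OF W]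

lemma avg_mX: "avg (mX r k) = avg (X r k)"
  and avg_mG_G: "avg (mG r k) = avg (G r k)" and avg_mH_H: "avg (mH r k) = avg (H r k)"
  by (simp_all add: mX_eq mG_eq mH_eq avg_mixed)

lemma avg_X_Suc: "avg (X r (Suc k)) = avg (X r k) + avg (S r k)"
  by (simp add: X_Suc avg_mixed avg_add avg_mX)

text \<open>Mixing preserves averages, so the increments of a tracker telescope.\<close>

lemma avg_mG: "avg (mG r k) = avg (\<lambda>i. grad (f i) (X r k i))"
proof (induction k)
  case 0
  show ?case by (simp add: avg_mG_G G_0)
next
  case (Suc k)
  then show ?case
    by (simp add: avg_mG_G[of "Suc k"] G_Suc avg_mixed avg_add avg_diff)
qed

lemma avg_mH: "avg (mH r k) = avg (\<lambda>i. hess (f i) (X r k i))"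
proof (induction k)
  case 0
  show ?case by (simp add: avg_mH_H H_0)
next
  case (Suc k)
  then show ?case
    by (simp add: avg_mH_H[of "Suc k"] H_Suc avg_mixed avg_add avg_diff)
qed

subsection \<open>The regularised local Hessians\<close>

lemma mix_symmetric:
  assumes "\<And>j. transpose (B j) = (B j :: real^'d^'d)"
  shows "transpose (mix A B i) = mix A B i"
  using assms by (simp add: vec_eq_iff transpose_def mix_def sum_component)

text \<open>Symmetry is what makes \<^const>\<open>lambda_min\<close> the least eigenvalue of the local trackers.\<close>

lemma mH_symmetric: "transpose (mH r k i) = mH r k i"
proof -
  have "transpose (H r k i) = H r k i" for i
  proof (induction k arbitrary: i)
    case 0
    show ?case by (simp add: H_0 f.hess_symmetric)
  next
    case (Suc k)
    have "transpose (mH r k j) = mH r k j" for j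
      unfolding mH_eq by (rule mix_symmetric) (rule Suc)
    moreover have "transpose (A + (B - B')) = transpose A + (transpose B - transpose B')"
      for A B B' :: "real^'d^'d"
      by (simp add: vec_eq_iff transpose_def)
    ultimately show ?case
      unfolding H_Suc by (intro mix_symmetric) (simp add: f.hess_symmetric)
  qed
  then show ?thesis unfolding mH_eq by (rule mix_symmetric)
qed

lemma avg_matrix_vector: "avg B *v v = avg (\<lambda>i. (B i :: real^'d^'d) *v v)"
proof -
  have "linear (\<lambda>A :: real^'d^'d. A *v v)"
    by (intro linearI) (simp_all add: matrix_vector_mult_add_rdistrib scaleR_matrix_vector_assoc)
  then show ?thesis
    by (intro avg_bounded_linear[where h = "\<lambda>A. A *v v"] linear_conv_bounded_linear[THEN iffD1])
qed

lemma inner_avg: "v \<bullet> avg u = avg (\<lambda>i. v \<bullet> (u i :: real^'d))"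
  by (rule avg_bounded_linear) (rule bounded_linear_inner_right)

lemma avg_mH_psd: "0 \<le> v \<bullet> (avg (mH r k) *v v)"
  unfolding avg_mH avg_matrix_vector inner_avg by (rule avg_ge) (rule f.hess_psd)

lemma spec_norm_avg_mH_le: "spec_norm (avg (mH r k)) \<le> L1"
proof (rule spec_norm_leI)
  fix v
  have "norm (hess (f i) x *v v) \<le> L1 * norm v" for i x
    using norm_matrix_vector_le_spec_norm f.spec_norm_hess_le
    by (meson mult_right_mono norm_ge_zero order_trans)
  then show "norm (avg (mH r k) *v v) \<le> L1 * norm v"
    unfolding avg_mH avg_matrix_vector by (intro norm_avg_le_bound)
qed

lemma del_nonneg: "0 \<le> del r k i"
  by (simp add: del_def)

text \<open>By convexity the averaged Hessian tracker is positive semidefinite, so a negative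
  eigenvalue of a local one can only come from its deviation from the average.\<close>

lemma del_le_deviation: "del r k i \<le> spec_norm (mH r k i - avg (mH r k))"
proof -
  obtain v where v: "norm v = 1" "v \<bullet> (mH r k i *v v) = lambda_min (mH r k i)"
    using lambda_min_Rayleigh(1)[OF mH_symmetric] by blast
  have "- (v \<bullet> ((mH r k i - avg (mH r k)) *v v)) \<le> spec_norm (mH r k i - avg (mH r k))"
    using Cauchy_Schwarz_ineq2[of v "(mH r k i - avg (mH r k)) *v v"] v(1)
      norm_matrix_vector_le_spec_norm[of "mH r k i - avg (mH r k)" v] by simp
  moreover have "v \<bullet> (mH r k i *v v)
      = v \<bullet> (avg (mH r k) *v v) + v \<bullet> ((mH r k i - avg (mH r k)) *v v)"
    by (simp add: matrix_vector_mult_diff_rdistrib inner_diff_right)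
  ultimately have "- lambda_min (mH r k i) \<le> spec_norm (mH r k i - avg (mH r k))"
    using avg_mH_psd[of v k] v(2) by linarith
  then show ?thesis by (simp add: del_def spec_norm_nonneg)
qed

lemma shifted_mH_psd: "0 \<le> v \<bullet> ((mH r k i + del r k i *\<^sub>R mat 1) *v v)"
proof -
  have "- lambda_min (mH r k i) * (v \<bullet> v) \<le> del r k i * (v \<bullet> v)"
    by (intro mult_right_mono) (auto simp: del_def)
  then show ?thesis
    using lambda_min_Rayleigh(2)[OF mH_symmetric, of k i v]
    by (simp add: matrix_vector_mult_add_rdistrib inner_add_right
        scaleR_matrix_vector_assoc[symmetric])
qed

lemma lam_nonneg: "0 \<le> lam M r k i"
  using M_pos by (simp add: lam_def)

lemma lam_square: "lam M r k i * lam M r k i = M * norm (mG r k i)"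
  using M_pos by (simp add: lam_def)

text \<open>The gradient regularisation dominates \<open>M\<close> times the step length, because its square is
  \<open>M\<close> times the gradient norm.  This bounds the steps, and later makes the regularisation
  absorb the second-order Taylor remainder.\<close>

lemma step_le_lam: "M * norm (S r k i) \<le> lam M r k i"
proof (cases "lam M r k i = 0")
  case True
  then have "mG r k i = 0" using M_pos by (simp add: lam_def)
  then have "S r k i = 0" using step_rule[of k i] by simp
  then show ?thesis using lam_nonneg by simp
next
  case False
  have "lam M r k i * norm (S r k i) \<le> norm (mG r k i)"
    using shifted_matrix_lower_bound[OF shifted_mH_psd, of "lam M r k i" "S r k i" k i]
      step_equation[of k i] by (simp add: scaleR_add_left add.assoc add.commute[of "del r k i *\<^sub>R mat 1"])
  then have "M * (lam M r k i * norm (S r k i)) \<le> lam M r k i * lam M r k i"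
    unfolding lam_square using M_pos by simp
  then show ?thesis
    using False lam_nonneg[of k i] by (simp add: mult.left_commute[of M])
qed

subsection \<open>Uniform bounds\<close>

lemma iterate_distances:
  shows "norm (avg (X r k) - X r 0 i) \<le> 2 * D" "norm (X r k i - X r l i) \<le> 2 * D"
    and "dispersion (X r k) \<le> real CARD('n) * (2 * D)"
    and "dispersion (mX r k) \<le> real CARD('n) * (2 * D)"
    and "0 \<le> D"
proof -
  obtain xs where xs: "\<And>k. norm (avg (X r k) - xs) \<le> D"
    "\<And>k i. norm (X r k i - xs) \<le> D" "\<And>k i. norm (mX r k i - xs) \<le> D"
    using bounded unfolding bounded_iterates_def by blast
  show "norm (avg (X r k) - X r 0 i) \<le> 2 * D"
    using norm_triangle_ineq4[of "avg (X r k) - xs" "X r 0 i - xs"] xs(1)[of k] xs(2)[of 0 i] by simp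
  show "norm (X r k i - X r l i) \<le> 2 * D"
    using norm_triangle_ineq4[of "X r k i - xs" "X r l i - xs"] xs(2)[of k i] xs(2)[of l i] by simp
  show "dispersion (X r k) \<le> real CARD('n) * (2 * D)"
    by (rule dispersion_le_radius[where c = xs]) (rule xs)
  show "dispersion (mX r k) \<le> real CARD('n) * (2 * D)"
    by (rule dispersion_le_radius[where c = xs]) (rule xs)
  show "0 \<le> D" using order_trans[OF norm_ge_zero xs(1)] .
qed

lemma grad_bound:
  assumes "norm (x - X r 0 i) \<le> 2 * D"
  shows "norm (grad (f i) x) \<le> norm (G r 0 i) + 2 * L1 * D"
proof -
  have "norm (grad (f i) x - G r 0 i) \<le> L1 * (2 * D)"
    unfolding G_0
    by (rule order_trans[OF f.grad_Lipschitz mult_left_mono[OF assms L1_nonneg]])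
  then show ?thesis
    using norm_triangle_ineq[of "grad (f i) x - G r 0 i" "G r 0 i"] by simp
qed

lemma avg_grad_bound:
  assumes "\<And>i. norm (x i - X r 0 i) \<le> 2 * D"
  shows "norm (avg (\<lambda>i. grad (f i) (x i))) \<le> mean_gradient_bound L1 D (G r 0)"
proof -
  have "norm (avg (\<lambda>i. grad (f i) (x i))) \<le> avg (\<lambda>i. norm (G r 0 i) + 2 * L1 * D)"
    by (rule order_trans[OF norm_avg_le avg_mono[OF grad_bound[OF assms]]])
  then show ?thesis by (simp add: mean_gradient_bound_def avg_add)
qed

lemma dispersion_mixed:
  "dispersion (mix (mpow W (t k)) v) \<le> decay (Suc k) * dispersion (v :: 'n \<Rightarrow> 'b::euclidean_space)"
  using dispersion_mix_mpow[OF W, of "t k" v] contraction[of k]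
    mult_right_mono[OF contraction[of k] dispersion_nonneg[of v]] by linarith

lemma dispersion_mG:
  "dispersion (mG r k) \<le> gradient_dispersion_bound L1 D (G r 0) * (decay k)\<^sup>2"
proof -
  define b where "b = real CARD('n) * (2 * (L1 * (2 * D)))"
  have b: "0 \<le> b" using L1_nonneg iterate_distances(5) by (simp add: b_def)
  have "dispersion (G r (Suc k)) \<le> decay (Suc k) * (dispersion (mG r k) + b)" for k
  proof -
    let ?d = "\<lambda>j. grad (f j) (X r (Suc k) j) - grad (f j) (X r k j)"
    have "norm (?d j - 0) \<le> L1 * (2 * D)" for j
      using f.grad_Lipschitz[of j "X r (Suc k) j" "X r k j"] L1_nonneg
        mult_left_mono[OF iterate_distances(2)[of "Suc k" j k] L1_nonneg] by simp
    then have "dispersion ?d \<le> b"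
      unfolding b_def by (rule dispersion_le_radius)
    then have "dispersion (\<lambda>j. mG r k j + ?d j) \<le> dispersion (mG r k) + b"
      using dispersion_triangle[of "mG r k" ?d] by linarith
    then have "decay (Suc k) * dispersion (\<lambda>j. mG r k j + ?d j)
        \<le> decay (Suc k) * (dispersion (mG r k) + b)"
      by (intro mult_left_mono decay_nonneg)
    then show ?thesis
      using dispersion_mixed[of k "\<lambda>j. mG r k j + ?d j"] unfolding G_Suc by linarith
  qed
  then show ?thesis
    using tracker_decay[of "\<lambda>k. dispersion (mG r k)" "\<lambda>k. dispersion (G r k)" b k] b
      dispersion_mixed[of _ "G r _"]
    by (simp add: mG_eq gradient_dispersion_bound_def b_def)
qed

text \<open>The dimension factor in the bound passes from the spectral norm of Hessian increments
  to the Frobenius norm, which comes from an inner product and so is contracted by mixing.\<close>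

lemma dispersion_mH:
  "dispersion (mH r k) \<le> hessian_dispersion_bound L2 D (H r 0) * (decay k)\<^sup>2"
proof -
  define b where "b = real CARD('n) * (2 * ((real CARD('d))\<^sup>2 * (L2 * (2 * D))))"
  have b: "0 \<le> b" using L2_nonneg iterate_distances(5) by (simp add: b_def)
  have "dispersion (H r (Suc k)) \<le> decay (Suc k) * (dispersion (mH r k) + b)" for k
  proof -
    let ?d = "\<lambda>j. hess (f j) (X r (Suc k) j) - hess (f j) (X r k j)"
    have "norm (?d j - 0) \<le> (real CARD('d))\<^sup>2 * (L2 * (2 * D))" for j
    proof -
      have "spec_norm (?d j) \<le> L2 * (2 * D)"
        using f.hess_Lipschitz[of j "X r (Suc k) j" "X r k j"]
          mult_left_mono[OF iterate_distances(2)[of "Suc k" j k] L2_nonneg] by linarith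
      then have "(real CARD('d))\<^sup>2 * spec_norm (?d j) \<le> (real CARD('d))\<^sup>2 * (L2 * (2 * D))"
        by (intro mult_left_mono) auto
      then show ?thesis using order_trans[OF norm_le_spec_norm[of "?d j"]] by simp
    qed
    then have "dispersion ?d \<le> b"
      unfolding b_def by (rule dispersion_le_radius)
    then have "dispersion (\<lambda>j. mH r k j + ?d j) \<le> dispersion (mH r k) + b"
      using dispersion_triangle[of "mH r k" ?d] by linarith
    then have "decay (Suc k) * dispersion (\<lambda>j. mH r k j + ?d j)
        \<le> decay (Suc k) * (dispersion (mH r k) + b)"
      by (intro mult_left_mono decay_nonneg)
    then show ?thesis
      using dispersion_mixed[of k "\<lambda>j. mH r k j + ?d j"] unfolding H_Suc by linarith
  qed
  then show ?thesis
    using tracker_decay[of "\<lambda>k. dispersion (mH r k)" "\<lambda>k. dispersion (H r k)" b k] b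
      dispersion_mixed[of _ "H r _"]
    by (simp add: mH_eq hessian_dispersion_bound_def b_def)
qed

lemma mean_gradient_bound_nonneg: "0 \<le> mean_gradient_bound L1 D (G r 0)"
  using L1_nonneg iterate_distances(5) by (auto simp: mean_gradient_bound_def intro!: add_nonneg_nonneg avg_ge)

lemma gradient_dispersion_bound_nonneg: "0 \<le> gradient_dispersion_bound L1 D (G r 0)"
  using L1_nonneg iterate_distances(5) by (simp add: gradient_dispersion_bound_def)

lemma hessian_dispersion_bound_nonneg: "0 \<le> hessian_dispersion_bound L2 D (H r 0)"
  using L2_nonneg iterate_distances(5) by (simp add: hessian_dispersion_bound_def)

lemma norm_mG_le: "norm (mG r k i) \<le> tracker_bound L1 D (G r 0)"
proof -
  have "norm (mG r k i - avg (mG r k)) \<le> gradient_dispersion_bound L1 D (G r 0)"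
    using deviation_le_dispersion[of "mG r k" i] dispersion_mG[of k]
      mult_left_le[of "(decay k)\<^sup>2" "gradient_dispersion_bound L1 D (G r 0)"]
      power_le_one[of "decay k" 2] decay_pos[of k] decay_le_1[of k]
      gradient_dispersion_bound_nonneg by linarith
  moreover have "norm (avg (mG r k)) \<le> mean_gradient_bound L1 D (G r 0)"
    unfolding avg_mG by (rule avg_grad_bound) (rule iterate_distances)
  ultimately show ?thesis
    using norm_triangle_ineq[of "mG r k i - avg (mG r k)" "avg (mG r k)"]
    by (simp add: tracker_bound_def)
qed

lemma norm_S_le: "norm (S r k i) \<le> step_bound L1 D M (G r 0)"
proof -
  have "M * norm (S r k i) \<le> sqrt (M * tracker_bound L1 D (G r 0))"
    using step_le_lam[of k i] norm_mG_le[of k i] M_pos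
    by (auto simp: lam_def elim!: order_trans)
  also have "\<dots> = M * step_bound L1 D M (G r 0)"
    using M_pos by (simp add: step_bound_def real_sqrt_mult real_sqrt_divide field_simps)
  finally show ?thesis using M_pos by simp
qed

lemma dispersion_X:
  "dispersion (X r k) \<le> iterate_dispersion_bound L1 D M (G r 0) * decay k"
proof (cases k)
  case 0
  have "0 \<le> step_bound L1 D M (G r 0)"
    using norm_S_le[of 0] norm_ge_zero order_trans by blast
  then have "0 \<le> real CARD('n) * (2 * step_bound L1 D M (G r 0))" by simp
  then show ?thesis
    using iterate_distances(3)[of 0] 0 by (simp add: decay_def iterate_dispersion_bound_def)
next
  case (Suc l)
  have "dispersion (S r l) \<le> real CARD('n) * (2 * step_bound L1 D M (G r 0))"
    by (rule dispersion_le_radius[where c = 0]) (simp add: norm_S_le)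
  then have "dispersion (\<lambda>j. mX r l j + S r l j) \<le> iterate_dispersion_bound L1 D M (G r 0)"
    using dispersion_triangle[of "mX r l" "S r l"] iterate_distances(4)[of l]
    by (simp add: iterate_dispersion_bound_def)
  then have "decay (Suc l) * dispersion (\<lambda>j. mX r l j + S r l j)
      \<le> decay (Suc l) * iterate_dispersion_bound L1 D M (G r 0)"
    by (intro mult_left_mono decay_nonneg)
  then show ?thesis
    using dispersion_mixed[of l "\<lambda>j. mX r l j + S r l j"] Suc
    unfolding X_Suc Suc by (simp add: mult.commute)
qed

lemma GDERIV_favg: "GDERIV (favg f) x :> avg (\<lambda>i. grad (f i) x)"
proof -
  have "((\<lambda>x. \<Sum>i\<in>UNIV. f i x) has_derivative (\<lambda>h. \<Sum>i\<in>UNIV. h \<bullet> grad (f i) x)) (at x)"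
    by (rule has_derivative_sum) (rule f.GDERIV_h[unfolded gderiv_def])
  then have "((\<lambda>x. (1 / real CARD('n)) *\<^sub>R (\<Sum>i\<in>UNIV. f i x))
      has_derivative (\<lambda>h. (1 / real CARD('n)) *\<^sub>R (\<Sum>i\<in>UNIV. h \<bullet> grad (f i) x))) (at x)"
    by (rule has_derivative_scaleR_right)
  then show ?thesis
    by (simp add: gderiv_def favg_def[abs_def] avg_def inner_sum_right)
qed

lemma gbar_eq: "gbar f r k = avg (\<lambda>i. grad (f i) (avg (X r k)))"
  unfolding gbar_def by (rule grad_eqI) (rule GDERIV_favg)

lemma favg_above_tangent:
  "favg f x + avg (\<lambda>i. grad (f i) x) \<bullet> (y - x) \<le> favg f y"
proof -
  have "avg (\<lambda>i. f i x + (y - x) \<bullet> grad (f i) x) \<le> favg f y"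
    unfolding favg_def by (rule avg_mono) (use f.above_tangent in \<open>simp add: inner_commute\<close>)
  then show ?thesis
    by (simp add: favg_def avg_add inner_avg inner_commute[of "avg _"])
qed

abbreviation C where "C \<equiv> run_bound L1 L2 D M (G r 0) (H r 0)"

lemma run_bounds:
  shows C_ge_1: "1 \<le> C"
    and "dispersion (X r k) \<le> C * decay k"
    and "dispersion (mG r k) \<le> C * (decay k)\<^sup>2"
    and "dispersion (mH r k) \<le> C * (decay k)\<^sup>2"
    and "norm (mG r k i) \<le> C" and "norm (S r k i) \<le> C" and "norm (gbar f r k) \<le> C"
proof -
  have s: "0 \<le> step_bound L1 D M (G r 0)"
    using norm_S_le[of 0] norm_ge_zero order_trans by blast
  then have i: "0 \<le> iterate_dispersion_bound L1 D M (G r 0)"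
    using iterate_distances(5) by (simp add: iterate_dispersion_bound_def)
  note nn = s i mean_gradient_bound_nonneg gradient_dispersion_bound_nonneg
    hessian_dispersion_bound_nonneg
  show "1 \<le> C" using nn by (simp add: run_bound_def tracker_bound_def)
  have le: "iterate_dispersion_bound L1 D M (G r 0) \<le> C"
    "gradient_dispersion_bound L1 D (G r 0) \<le> C" "hessian_dispersion_bound L2 D (H r 0) \<le> C"
    "tracker_bound L1 D (G r 0) \<le> C" "step_bound L1 D M (G r 0) \<le> C"
    "mean_gradient_bound L1 D (G r 0) \<le> C"
    using nn by (simp_all add: run_bound_def tracker_bound_def)
  show "dispersion (X r k) \<le> C * decay k"
    using dispersion_X[of k] mult_right_mono[OF le(1) less_imp_le[OF decay_pos[of k]]] by linarith
  show "dispersion (mG r k) \<le> C * (decay k)\<^sup>2"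
    using dispersion_mG[of k] mult_right_mono[OF le(2) zero_le_power2[of "decay k"]] by linarith
  show "dispersion (mH r k) \<le> C * (decay k)\<^sup>2"
    using dispersion_mH[of k] mult_right_mono[OF le(3) zero_le_power2[of "decay k"]] by linarith
  show "norm (mG r k i) \<le> C" using norm_mG_le[of k i] le by linarith
  show "norm (S r k i) \<le> C" using norm_S_le[of k i] le by linarith
  have "norm (gbar f r k) \<le> mean_gradient_bound L1 D (G r 0)"
    unfolding gbar_eq by (rule avg_grad_bound) (rule iterate_distances)
  then show "norm (gbar f r k) \<le> C" using le by linarith
qed

end

section \<open>The burn-in inequalities\<close>

lemma avg_le_root_mean_square:
  fixes a :: "'n::finite \<Rightarrow> real"
  shows "avg a \<le> sqrt (avg (\<lambda>i. (a i)\<^sup>2))"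
proof (rule real_le_rsqrt)
  have "(\<Sum>i\<in>UNIV. a i)\<^sup>2 \<le> (\<Sum>i\<in>UNIV. (a i)\<^sup>2) * real CARD('n)"
    by (rule sum_squared_le_sum_of_squares)
  then show "(avg a)\<^sup>2 \<le> avg (\<lambda>i. (a i)\<^sup>2)"
    by (simp add: avg_def power_divide divide_simps power2_eq_square mult.commute)
qed

lemma disp_X_le_dispersion: "disp_X r k \<le> dispersion (X r k)"
proof -
  have "avg a \<le> (\<Sum>i\<in>UNIV. a i)" if "\<And>i. 0 \<le> a i" for a :: "'b \<Rightarrow> real"
    using that by (intro avg_le member_le_sum) auto
  from this[of "\<lambda>i. (norm (X r k i - avg (X r k)))\<^sup>2"]
  have "avg (\<lambda>i. (norm (X r k i - avg (X r k)))\<^sup>2)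
      \<le> (\<Sum>i\<in>UNIV. (norm (X r k i - avg (X r k)))\<^sup>2)" by simp
  then show ?thesis by (simp add: disp_X_def dispersion_def L2_set_def)
qed

lemma abs_sqrt_diff_le:
  assumes "0 \<le> a" "0 \<le> b"
  shows "\<bar>sqrt a - sqrt b\<bar> \<le> sqrt \<bar>a - b\<bar>"
proof -
  have "sqrt x - sqrt y \<le> sqrt (x - y)" if "0 \<le> y" "y \<le> x" for x y :: real
    using sqrt_add_le_add_sqrt[of y "x - y"] that by simp
  from this[of b a] this[of a b] show ?thesis
    using assms by (cases "b \<le> a") (auto simp: abs_if)
qed

definition regularisation_bound :: "real \<Rightarrow> real \<Rightarrow> real" where
  "regularisation_bound M C = sqrt (M * C) + C"

definition step_error_bound :: "real \<Rightarrow> real \<Rightarrow> real" where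
  "step_error_bound M C = C + C * (C + (sqrt (2 * M * C) + C))"

text \<open>In this constant \<open>P\<close> bounds the reference matrix, \<open>E\<close> the error of the averaged step,
  multiplied by the regularisation, in units of \<open>decay k\<close>, and \<open>m\<close> is such that the
  regularisation is at least \<open>m \<epsilon>\<close> while the gradient is at least \<open>\<epsilon>\<close>.  Each summand makes
  one error term of the burn-in estimates small; 96 is the inverse of \<open>burn_in_eta / 8\<close>.\<close>

definition burn_in_bound :: "real \<Rightarrow> real \<Rightarrow> real \<Rightarrow> real \<Rightarrow> real" where
  "burn_in_bound L1 L2 M C =
     (let m = sqrt (M / 2); P = L1 + regularisation_bound M C; E = step_error_bound M C
      in 4 * C + 4 * (L1 * C) + 4 * (P * E / m) + 192 * (P\<^sup>2 * E / m\<^sup>2)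
         + 192 * (L1 * C * P / m) + 96 * (L2 * C / m))"

context disgrem_run
begin

lemma avg_distance_le_disp_X: "avg (\<lambda>i. norm (X r k i - avg (X r k))) \<le> disp_X r k"
  unfolding disp_X_def by (rule avg_le_root_mean_square)

text \<open>The averaged trackers differ from the derivatives of the mean objective at the mean
  iterate only through the dispersion of the iterates.\<close>

lemma gradient_tracking: "norm (avg (mG r k) - gbar f r k) \<le> L1 * disp_X r k"
proof -
  have "avg (mG r k) - gbar f r k
      = avg (\<lambda>i. grad (f i) (X r k i) - grad (f i) (avg (X r k)))"
    by (simp add: avg_mG gbar_eq avg_diff)
  also have "norm \<dots> \<le> avg (\<lambda>i. L1 * norm (X r k i - avg (X r k)))"
    by (rule order_trans[OF norm_avg_le avg_mono[OF f.grad_Lipschitz]])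
  also have "\<dots> \<le> L1 * disp_X r k"
    unfolding avg_mult_right by (intro mult_left_mono avg_distance_le_disp_X L1_nonneg)
  finally show ?thesis .
qed

lemma hessian_tracking:
  "norm (avg (mH r k) *v s - avg (\<lambda>i. hess (f i) (avg (X r k)) *v s)) \<le> L2 * disp_X r k * norm s"
proof -
  have "norm (hess (f i) x *v s - hess (f i) y *v s) \<le> norm s * (L2 * norm (x - y))" for i x y
  proof -
    have "norm (hess (f i) x *v s - hess (f i) y *v s)
        \<le> spec_norm (hess (f i) x - hess (f i) y) * norm s"
      using norm_matrix_vector_le_spec_norm[of "hess (f i) x - hess (f i) y" s]
      by (simp add: matrix_vector_mult_diff_rdistrib)
    also have "\<dots> \<le> L2 * norm (x - y) * norm s"
      by (intro mult_right_mono f.hess_Lipschitz norm_ge_zero)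
    finally show ?thesis by (simp only: mult.commute)
  qed
  then have "norm (avg (\<lambda>i. hess (f i) (X r k i) *v s - hess (f i) (avg (X r k)) *v s))
      \<le> avg (\<lambda>i. norm s * (L2 * norm (X r k i - avg (X r k))))"
    by (intro order_trans[OF norm_avg_le avg_mono])
  also have "\<dots> \<le> norm s * (L2 * disp_X r k)"
    unfolding avg_mult_right
    by (intro mult_left_mono avg_distance_le_disp_X L2_nonneg norm_ge_zero)
  finally show ?thesis
    by (simp add: avg_mH avg_matrix_vector avg_diff ac_simps)
qed

lemma mG_deviation: "norm (mG r k i - avg (mG r k)) \<le> C * (decay k)\<^sup>2"
  by (rule order_trans[OF deviation_le_dispersion run_bounds(3)])

lemma mH_deviation: "spec_norm (mH r k i - avg (mH r k)) \<le> C * (decay k)\<^sup>2"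
  by (rule order_trans[OF order_trans[OF spec_norm_le_norm deviation_le_dispersion] run_bounds(4)])

lemma decay_square_le: "C * (decay k)\<^sup>2 \<le> C * decay k"
  using C_ge_1 decay_nonneg[of k] decay_le_1[of k]
  by (intro mult_left_mono) (auto simp: power2_eq_square mult_left_le)

lemma lambar_nonneg: "0 \<le> lambar M r k"
  unfolding lambar_def using lam_nonneg del_nonneg by (intro avg_ge add_nonneg_nonneg)

lemma lambar_le: "lambar M r k \<le> regularisation_bound M C"
  unfolding lambar_def regularisation_bound_def
proof (intro avg_le add_mono)
  fix i
  show "lam M r k i \<le> sqrt (M * C)"
    using run_bounds(5)[of k i] M_pos by (simp add: lam_def)
  have "C * decay k \<le> C * 1"
    using decay_le_1[of k] C_ge_1 by (intro mult_left_mono) auto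
  then show "del r k i \<le> C"
    using del_le_deviation[of k i] mH_deviation[of k i] decay_square_le[of k] by linarith
qed

lemma regularisation_deviation:
  "\<bar>lambar M r k - (lam M r k i + del r k i)\<bar> \<le> (sqrt (2 * M * C) + C) * decay k"
proof -
  have pair: "\<bar>(lam M r k j + del r k j) - (lam M r k i + del r k i)\<bar>
      \<le> (sqrt (2 * M * C) + C) * decay k" for j
  proof -
    have "\<bar>norm (mG r k j) - norm (mG r k i)\<bar> \<le> norm (mG r k j - mG r k i)"
      by (rule norm_triangle_ineq3)
    also have "\<dots> \<le> 2 * (C * (decay k)\<^sup>2)"
      using norm_triangle_ineq4[of "mG r k j - avg (mG r k)" "mG r k i - avg (mG r k)"]
        mG_deviation[of k i] mG_deviation[of k j] by simp
    finally have "M * \<bar>norm (mG r k j) - norm (mG r k i)\<bar> \<le> M * (2 * (C * (decay k)\<^sup>2))"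
      using M_pos by simp
    then have "sqrt (M * \<bar>norm (mG r k j) - norm (mG r k i)\<bar>) \<le> sqrt (2 * M * C * (decay k)\<^sup>2)"
      by (simp add: ac_simps)
    also have "\<dots> = sqrt (2 * M * C) * decay k"
      using decay_nonneg by (simp add: real_sqrt_mult)
    finally have "\<bar>lam M r k j - lam M r k i\<bar> \<le> sqrt (2 * M * C) * decay k"
      using abs_sqrt_diff_le[of "M * norm (mG r k j)" "M * norm (mG r k i)"] M_pos
      by (simp add: lam_def abs_mult flip: right_diff_distrib)
    moreover have "\<bar>del r k j - del r k i\<bar> \<le> C * decay k"
      using del_nonneg[of k i] del_nonneg[of k j] del_le_deviation[of k i] del_le_deviation[of k j]
        mH_deviation[of k i] mH_deviation[of k j] decay_square_le[of k] by linarith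
    ultimately show ?thesis by (simp add: distrib_right)
  qed
  have "lambar M r k - (lam M r k i + del r k i)
      = avg (\<lambda>j. (lam M r k j + del r k j) - (lam M r k i + del r k i))"
    unfolding lambar_def by (subst avg_diff) simp
  then show ?thesis
    using norm_avg_le_bound[of "\<lambda>j. (lam M r k j + del r k j) - (lam M r k i + del r k i)", OF pair[folded real_norm_def]]
    by (simp only: real_norm_def)
qed

lemma A_ref_lower: "lambar M r k * norm v \<le> norm (A_ref M r k *v v)"
  unfolding A_ref_def by (rule shifted_matrix_lower_bound) (rule avg_mH_psd)

lemma A_ref_mult: "A_ref M r k *v v = avg (mH r k) *v v + lambar M r k *\<^sub>R v"
  by (simp add: A_ref_def matrix_vector_mult_add_rdistrib scaleR_matrix_vector_assoc[symmetric])

lemma A_ref_upper: "norm (A_ref M r k *v v) \<le> (L1 + lambar M r k) * norm v"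
proof -
  have "norm (avg (mH r k) *v v) \<le> L1 * norm v"
    by (rule order_trans[OF norm_matrix_vector_le_spec_norm
          mult_right_mono[OF spec_norm_avg_mH_le norm_ge_zero]])
  then show ?thesis
    unfolding A_ref_mult using lambar_nonneg
    by (intro order_trans[OF norm_triangle_ineq]) (simp add: distrib_right)
qed

lemma A_ref_invertible: "0 < lambar M r k \<Longrightarrow> invertible (A_ref M r k)"
  unfolding A_ref_def by (rule invertible_shifted_matrix) (rule avg_mH_psd)

lemma A_ref_s_ref:
  assumes "invertible (A_ref M r k)"
  shows "A_ref M r k *v s_ref M r k = - avg (mG r k)"
proof -
  have "A_ref M r k ** matrix_inv (A_ref M r k) = mat 1"
    using assms someI_ex unfolding invertible_def matrix_inv_def by (metis (mono_tags, lifting))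
  then show ?thesis
    unfolding s_ref_def
    by (simp add: vec.neg matrix_vector_mul_assoc)
qed

text \<open>Every local step solves the reference system up to the disagreement of the local
  gradients, Hessians and regularisations.  The latter enter through a square root, so they
  are only of order \<open>decay k\<close>, the square root of the dispersion of the gradients.\<close>

lemma step_error:
  assumes "0 < lambar M r k"
  shows "lambar M r k * norm (avg (S r k) - s_ref M r k) \<le> step_error_bound M C * decay k"
proof -
  have local: "norm (A_ref M r k *v (S r k i - s_ref M r k)) \<le> step_error_bound M C * decay k"
    for i
  proof -
    let ?c = "lam M r k i + del r k i"
    let ?e = "(avg (mH r k) - mH r k i) *v S r k i + (lambar M r k - ?c) *\<^sub>R S r k i"
    have "mH r k i *v S r k i + ?c *\<^sub>R S r k i = - mG r k i"
      using step_equation[of k i]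
      by (simp add: matrix_vector_mult_add_rdistrib scaleR_matrix_vector_assoc[symmetric])
    then have "A_ref M r k *v S r k i = - mG r k i + ?e"
      by (simp add: A_ref_mult matrix_vector_mult_diff_rdistrib algebra_simps)
    then have eq: "A_ref M r k *v (S r k i - s_ref M r k) = - (mG r k i - avg (mG r k)) + ?e"
      using A_ref_s_ref[OF A_ref_invertible[OF assms]]
      by (simp add: matrix_vector_mult_diff_distrib)
    have "norm ((avg (mH r k) - mH r k i) *v S r k i) \<le> C * decay k * norm (S r k i)"
    proof -
      have "norm ((mH r k i - avg (mH r k)) *v S r k i) \<le> C * decay k * norm (S r k i)"
        using norm_matrix_vector_le_spec_norm[of "mH r k i - avg (mH r k)" "S r k i"]
          mult_right_mono[OF order_trans[OF mH_deviation decay_square_le] norm_ge_zero, of k i "S r k i"]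
        by linarith
      then show ?thesis
        by (simp add: matrix_vector_mult_diff_rdistrib norm_minus_commute)
    qed
    moreover have "norm ((lambar M r k - ?c) *\<^sub>R S r k i)
        \<le> (sqrt (2 * M * C) + C) * decay k * norm (S r k i)"
      using regularisation_deviation[of k i] by (simp add: mult_right_mono)
    ultimately have "norm ?e \<le> (C + (sqrt (2 * M * C) + C)) * decay k * norm (S r k i)"
      using norm_triangle_ineq[of "(avg (mH r k) - mH r k i) *v S r k i" "(lambar M r k - ?c) *\<^sub>R S r k i"]
      by (simp add: distrib_right)
    also have "\<dots> \<le> (C + (sqrt (2 * M * C) + C)) * decay k * C"
      using C_ge_1 M_pos run_bounds(6) decay_nonneg
      by (intro mult_left_mono mult_nonneg_nonneg add_nonneg_nonneg) auto
    finally have "norm ?e \<le> (C + (sqrt (2 * M * C) + C)) * decay k * C" .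
    moreover have "norm (- (mG r k i - avg (mG r k))) \<le> C * decay k"
      using mG_deviation[of k i] decay_square_le[of k] by (simp add: norm_minus_commute)
    ultimately show ?thesis
      unfolding eq step_error_bound_def
      using norm_triangle_ineq[of "- (mG r k i - avg (mG r k))" ?e] by (simp add: algebra_simps)
  qed
  have "A_ref M r k *v (avg (S r k) - s_ref M r k) = avg (\<lambda>i. A_ref M r k *v (S r k i - s_ref M r k))"
  proof -
    have "avg (S r k) - s_ref M r k = avg (\<lambda>i. S r k i - s_ref M r k)"
      by (simp add: avg_diff)
    then show ?thesis
      by (simp add: avg_bounded_linear[OF matrix_vector_mul_bounded_linear])
  qed
  then have "norm (A_ref M r k *v (avg (S r k) - s_ref M r k)) \<le> step_error_bound M C * decay k"
    using norm_avg_le_bound[OF local] by simp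
  then show ?thesis by (rule order_trans[OF A_ref_lower])
qed

lemma burn_in_bound_pos: "0 < burn_in_bound L1 L2 M C"
proof -
  have "0 < C" "0 \<le> sqrt (M * C)" "0 \<le> sqrt (2 * M * C)" using C_ge_1 M_pos by auto
  then show ?thesis
    using L1_nonneg L2_nonneg M_pos
    by (auto simp: burn_in_bound_def Let_def regularisation_bound_def step_error_bound_def
        intro!: add_pos_nonneg)
qed

text \<open>Smallness of \<open>decay k\<close>, with denominators cleared, in the six forms that the
  burn-in estimates use.\<close>

lemma small_decay_consequences:
  assumes \<epsilon>: "0 < \<epsilon>" "\<epsilon> \<le> 1" and small: "burn_in_bound L1 L2 M C * decay k \<le> \<epsilon> ^ 3"
  defines "m \<equiv> sqrt (M / 2)" and "P \<equiv> L1 + regularisation_bound M C" and "E \<equiv> step_error_bound M C"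
  shows "4 * (C * decay k) \<le> \<epsilon> ^ 3" "4 * (L1 * C * decay k) \<le> \<epsilon> ^ 3"
    "4 * (P * E * decay k) \<le> \<epsilon> ^ 3 * m" "192 * (P\<^sup>2 * E * decay k) \<le> \<epsilon> ^ 3 * m\<^sup>2"
    "192 * (L1 * C * P * decay k) \<le> \<epsilon> ^ 3 * m" "96 * (L2 * C * decay k) \<le> \<epsilon> ^ 3 * m"
    "0 < m" "0 < P"
proof -
  have C: "0 \<le> C" using C_ge_1 by simp
  show m: "0 < m" using M_pos by (simp add: m_def)
  have "0 \<le> sqrt (M * C)" using C M_pos by simp
  then show P: "0 < P"
    using L1_nonneg C_ge_1 unfolding P_def regularisation_bound_def by linarith
  have E: "0 \<le> E"
    unfolding E_def step_error_bound_def using C M_pos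
    by (intro add_nonneg_nonneg mult_nonneg_nonneg) auto
  define w where "w = decay k"
  have w: "0 \<le> w" by (simp add: w_def decay_nonneg)
  define T where "T = [4 * C * w, 4 * (L1 * C) * w, 4 * (P * E / m) * w, 192 * (P\<^sup>2 * E / m\<^sup>2) * w,
     192 * (L1 * C * P / m) * w, 96 * (L2 * C / m) * w]"
  have "sum_list T \<le> \<epsilon> ^ 3"
    using small by (simp add: T_def burn_in_bound_def Let_def w_def distrib_right
        flip: m_def P_def E_def)
  moreover have "0 \<le> x" if "x \<in> set T" for x
    using that C m P E w L1_nonneg L2_nonneg unfolding T_def by (auto intro!: mult_nonneg_nonneg)
  ultimately have *: "x \<le> \<epsilon> ^ 3" if "x \<in> set T" for x
    using member_le_sum_list[OF that] order_trans that by blast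
  show "4 * (C * decay k) \<le> \<epsilon> ^ 3" "4 * (L1 * C * decay k) \<le> \<epsilon> ^ 3"
    "4 * (P * E * decay k) \<le> \<epsilon> ^ 3 * m" "192 * (P\<^sup>2 * E * decay k) \<le> \<epsilon> ^ 3 * m\<^sup>2"
    "192 * (L1 * C * P * decay k) \<le> \<epsilon> ^ 3 * m" "96 * (L2 * C * decay k) \<le> \<epsilon> ^ 3 * m"
    using *[of "4 * C * w"] *[of "4 * (L1 * C) * w"] *[of "4 * (P * E / m) * w"]
      *[of "192 * (P\<^sup>2 * E / m\<^sup>2) * w"] *[of "192 * (L1 * C * P / m) * w"] *[of "96 * (L2 * C / m) * w"] m
    by (simp_all add: T_def w_def field_simps)
qed

text \<open>As long as the gradient is at least \<open>\<epsilon>\<close>, the regularisation is at least of order \<open>\<epsilon>\<close>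
  and the step at least of order \<open>\<epsilon>\<close>, while all errors are of order \<open>\<epsilon>\<^sup>3\<close>.  (The true
  order of the regularisation is \<open>\<epsilon>\<^bsup>1/2\<^esup>\<close>, but this weaker bound suffices.)\<close>

lemma burn_in_step:
  assumes \<epsilon>: "0 < \<epsilon>" "\<epsilon> \<le> 1" and small: "burn_in_bound L1 L2 M C * decay k \<le> \<epsilon> ^ 3"
    and large: "\<epsilon> \<le> norm (gbar f r k)"
  shows "invertible (A_ref M r k)"
    and "norm (avg (S r k) - s_ref M r k)
          \<le> burn_in_eta / 8 * (lambar M r k / (L1 + lambar M r k)) * norm (avg (S r k))"
    and "L1 * disp_X r k \<le> burn_in_eta / 8 * lambar M r k * norm (avg (S r k))"
    and "L2 * disp_X r k \<le> burn_in_eta / 8 * lambar M r k"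
proof -
  define m where "m = sqrt (M / 2)"
  define P where "P = L1 + regularisation_bound M C"
  define E where "E = step_error_bound M C"
  note c = small_decay_consequences[OF \<epsilon> small, folded m_def P_def E_def]
  have m: "0 < m" and P: "0 < P" using c by auto
  have C: "0 \<le> C" using C_ge_1 by simp
  have \<epsilon>3: "\<epsilon> ^ 3 \<le> \<epsilon>" "\<epsilon> ^ 3 \<le> \<epsilon>\<^sup>2"
    using power_decreasing[of 1 3 \<epsilon>] power_decreasing[of 2 3 \<epsilon>] \<epsilon> by auto
  have dX: "disp_X r k \<le> C * decay k"
    by (rule order_trans[OF disp_X_le_dispersion run_bounds(2)])
  have dX1: "L1 * disp_X r k \<le> L1 * C * decay k" and dX2: "L2 * disp_X r k \<le> L2 * C * decay k"
    using mult_left_mono[OF dX L1_nonneg] mult_left_mono[OF dX L2_nonneg] by (simp_all add: mult.assoc)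
  have avg_large: "\<epsilon> - \<epsilon> / 4 \<le> norm (avg (mG r k))"
    using gradient_tracking[of k] large dX1 c(2) \<epsilon>3
      norm_triangle_ineq2[of "gbar f r k" "avg (mG r k)"] by (simp add: norm_minus_commute)
  have lam_large: "m * \<epsilon> \<le> lam M r k i" for i
  proof -
    have "\<epsilon> / 2 \<le> norm (mG r k i)"
      using avg_large mG_deviation[of k i] decay_square_le[of k] c(1) \<epsilon>3
        norm_triangle_ineq2[of "avg (mG r k)" "mG r k i"] by (simp add: norm_minus_commute)
    then have "M * (\<epsilon> / 2) \<le> M * norm (mG r k i)"
      using M_pos by (intro mult_left_mono) auto
    moreover have "(m * \<epsilon>)\<^sup>2 \<le> M * (\<epsilon> / 2)"
      using \<epsilon> M_pos by (simp add: m_def power_mult_distrib power2_eq_square[of \<epsilon>] mult_left_le)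
    ultimately show ?thesis
      unfolding lam_def by (intro real_le_rsqrt) simp
  qed
  define l where "l = lambar M r k"
  have l_large: "m * \<epsilon> \<le> l"
    unfolding l_def lambar_def using lam_large del_nonneg by (intro avg_ge) (simp add: add_increasing2)
  have l_pos: "0 < l" using l_large m \<epsilon> mult_pos_pos[of m \<epsilon>] by linarith
  have l_le: "L1 + l \<le> P" unfolding P_def l_def using lambar_le by simp
  show inv: "invertible (A_ref M r k)"
    using A_ref_invertible l_pos by (simp add: l_def)
  define e where "e = norm (avg (S r k) - s_ref M r k)"
  have e: "m * \<epsilon> * e \<le> E * decay k"
  proof -
    have "m * \<epsilon> * e \<le> l * e" using l_large by (intro mult_right_mono) (auto simp: e_def)
    also have "\<dots> \<le> E * decay k"
      using step_error[of k] l_pos by (simp add: l_def e_def E_def)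
    finally show ?thesis .
  qed
  have e_small: "4 * P * e \<le> \<epsilon>"
  proof -
    have "m * \<epsilon> * (4 * P * e) \<le> 4 * P * (E * decay k)"
      using mult_left_mono[OF e, of "4 * P"] P by (simp add: ac_simps)
    also have "\<dots> \<le> \<epsilon> ^ 3 * m" using c(3) by (simp add: ac_simps)
    also have "\<dots> \<le> m * \<epsilon> * \<epsilon>"
      using \<epsilon>3(2) m by (simp add: power2_eq_square ac_simps)
    finally show ?thesis using m \<epsilon> by simp
  qed
  have e_tiny: "192 * (P * P * e) \<le> m * (\<epsilon> * \<epsilon>)"
  proof -
    have "m * \<epsilon> * (192 * (P * P * e)) \<le> 192 * (P\<^sup>2 * E * decay k)"
      using mult_left_mono[OF e, of "192 * (P * P)"] P by (simp add: power2_eq_square ac_simps)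
    also have "\<dots> \<le> m * \<epsilon> * (m * (\<epsilon> * \<epsilon>))"
      using c(4) by (simp add: power2_eq_square power3_eq_cube ac_simps)
    finally show ?thesis using m \<epsilon> by simp
  qed
  define s where "s = norm (avg (S r k))"
  have s_large: "\<epsilon> \<le> 2 * (P * s)"
  proof -
    have "norm (avg (mG r k)) \<le> (L1 + l) * norm (s_ref M r k)"
      using A_ref_upper[of k "s_ref M r k"] A_ref_s_ref[OF inv] by (simp add: l_def)
    also have "\<dots> \<le> P * norm (s_ref M r k)"
      using l_le by (intro mult_right_mono) auto
    also have "\<dots> \<le> P * (s + e)"
      using norm_triangle_ineq2[of "s_ref M r k" "avg (S r k)"] P
      by (intro mult_left_mono) (auto simp: s_def e_def norm_minus_commute)
    finally show ?thesis using avg_large e_small by (simp add: distrib_left)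
  qed
  have s0: "0 \<le> s" by (simp add: s_def)
  have ls: "m * (\<epsilon> * \<epsilon>) \<le> 2 * P * (l * s)"
  proof -
    have "m * \<epsilon> * \<epsilon> \<le> l * (2 * (P * s))"
      using l_large s_large m \<epsilon> l_pos by (intro mult_mono) auto
    then show ?thesis by (simp add: ac_simps)
  qed
  have "96 * P * e \<le> l * s"
  proof -
    have "2 * P * (96 * P * e) \<le> 2 * P * (l * s)" using e_tiny ls by (simp add: ac_simps)
    then show ?thesis using P by simp
  qed
  moreover have "96 * (L1 + l) * e \<le> 96 * P * e"
    using l_le by (intro mult_right_mono) (auto simp: e_def)
  ultimately have "96 * (L1 + l) * e \<le> l * s" by linarith
  then show "norm (avg (S r k) - s_ref M r k)
      \<le> burn_in_eta / 8 * (lambar M r k / (L1 + lambar M r k)) * norm (avg (S r k))"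
    using l_pos L1_nonneg unfolding burn_in_eta_def
    by (simp add: field_simps flip: l_def e_def s_def)
  have "2 * P * (96 * (L1 * disp_X r k)) \<le> 192 * (L1 * C * P * decay k)"
    using mult_left_mono[OF dX1, of "192 * P"] P by (simp add: ac_simps)
  also have "\<dots> \<le> \<epsilon>\<^sup>2 * m"
    using c(5) \<epsilon>3(2) m by (meson mult_right_mono less_imp_le order_trans)
  also have "\<dots> \<le> 2 * P * (l * s)" using ls by (simp add: power2_eq_square ac_simps)
  finally have "96 * (L1 * disp_X r k) \<le> l * s" using P by simp
  then show "L1 * disp_X r k \<le> burn_in_eta / 8 * lambar M r k * norm (avg (S r k))"
    by (simp add: burn_in_eta_def l_def s_def)
  have "96 * (L2 * disp_X r k) \<le> \<epsilon> * m"
    using dX2 c(6) mult_right_mono[OF \<epsilon>3(1), of m] m by linarith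
  then show "L2 * disp_X r k \<le> burn_in_eta / 8 * lambar M r k"
    using l_large by (simp add: burn_in_eta_def l_def mult.commute)
qed

lemma burn_in_dispersions:
  assumes \<epsilon>: "0 < \<epsilon>" "\<epsilon> \<le> 1" and small: "burn_in_bound L1 L2 M C * decay k \<le> \<epsilon> ^ 3"
  shows "disp_G r k \<le> \<epsilon>\<^sup>2" "disp_H r k \<le> \<epsilon> powr (3 / 2)" "disp_X r k \<le> \<epsilon> powr (3 / 2)"
    "avg (del r k) \<le> (1 + L2) * \<epsilon> powr (3 / 2)"
proof -
  have "0 \<le> C * decay k" using C_ge_1 decay_nonneg by simp
  then have "C * decay k \<le> \<epsilon> ^ 3"
    using small_decay_consequences(1)[OF \<epsilon> small] by linarith
  moreover have "\<epsilon> ^ 3 \<le> \<epsilon>\<^sup>2" using power_decreasing[of 2 3 \<epsilon>] \<epsilon> by auto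
  moreover have "\<epsilon>\<^sup>2 \<le> \<epsilon> powr (3 / 2)"
    using powr_mono'[of "3 / 2" 2 \<epsilon>] \<epsilon> by (simp add: powr_numeral)
  ultimately have C2: "C * decay k \<le> \<epsilon>\<^sup>2" and Cp: "C * decay k \<le> \<epsilon> powr (3 / 2)" by linarith+
  show "disp_G r k \<le> \<epsilon>\<^sup>2"
    unfolding disp_G_def using mG_deviation decay_square_le C2 by (meson avg_le order_trans)
  have dev: "spec_norm (mH r k i - avg (mH r k)) \<le> \<epsilon> powr (3 / 2)" for i
    using mH_deviation[of k i] decay_square_le[of k] Cp by linarith
  show "disp_H r k \<le> \<epsilon> powr (3 / 2)"
    unfolding disp_H_def by (rule avg_le) (rule dev)
  show "disp_X r k \<le> \<epsilon> powr (3 / 2)"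
    using disp_X_le_dispersion[of r k] run_bounds(2)[of k] Cp by linarith
  have "avg (del r k) \<le> \<epsilon> powr (3 / 2)"
    by (rule avg_le) (rule order_trans[OF del_le_deviation dev])
  also have "\<dots> \<le> (1 + L2) * \<epsilon> powr (3 / 2)"
    using L2_nonneg by (simp add: distrib_right)
  finally show "avg (del r k) \<le> (1 + L2) * \<epsilon> powr (3 / 2)" .
qed

lemma burn_in_if_small_decay:
  assumes "0 < \<epsilon>" "\<epsilon> \<le> 1" and "burn_in_bound L1 L2 M C * decay K0 \<le> \<epsilon> ^ 3"
  shows "burn_in L1 L2 M f r \<epsilon> K0"
proof -
  have small: "burn_in_bound L1 L2 M C * decay k \<le> \<epsilon> ^ 3" if "K0 \<le> k" for k
    using assms(3) mult_left_mono[OF decay_antimono[OF that] less_imp_le[OF burn_in_bound_pos]]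
    by linarith
  show ?thesis
    unfolding burn_in_def
    by (intro conjI allI impI burn_in_step[OF assms(1,2) small]
        burn_in_dispersions[OF assms(1,2) small])
qed

section \<open>Decrease of the objective\<close>

text \<open>The second-order Taylor expansion and the equation solved by the reference step show
  that the new gradient is close to \<open>- \<lambda>\<^sub>k s\<close>, where \<open>s\<close> is the average step: the quadratic
  remainder is at most \<open>L2 / 2\<close> times the squared length of \<open>s\<close>, which the regularisation
  dominates because \<open>M\<close> times the length of \<open>s\<close> is at most \<open>\<lambda>\<^sub>k\<close>.  By convexity the decrease
  is then of order \<open>\<lambda>\<^sub>k\<close> times the squared length of \<open>s\<close>, hence of the order of the squared
  new gradient.\<close>

lemma next_gradient:
  assumes "burn_in L1 L2 M f r \<epsilon> K0" "K0 \<le> k" "\<epsilon> \<le> norm (gbar f r k)"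
  shows "norm (gbar f r (Suc k) + lambar M r k *\<^sub>R avg (S r k))
    \<le> 3 / 4 * lambar M r k * norm (avg (S r k))"
proof -
  define l where "l = lambar M r k"
  define s where "s = avg (S r k)"
  define x where "x = avg (X r k)"
  have inv: "invertible (A_ref M r k)"
    and b1: "norm (s - s_ref M r k) \<le> 1 / 96 * (l / (L1 + l)) * norm s"
    and b2: "L1 * disp_X r k \<le> 1 / 96 * l * norm s"
    and b3: "L2 * disp_X r k \<le> 1 / 96 * l"
    using assms unfolding burn_in_def burn_in_eta_def l_def s_def by auto
  have l: "0 \<le> l" by (simp add: l_def lambar_nonneg)
  have T: "norm (avg (\<lambda>i. grad (f i) (x + s) - grad (f i) x - hess (f i) x *v s)) \<le> 1 / 2 * l * norm s"
  proof -
    have "M * norm s \<le> avg (\<lambda>i. M * norm (S r k i))"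
      unfolding avg_mult_right s_def using M_pos norm_avg_le[of "S r k"] by simp
    also have "\<dots> \<le> l"
      unfolding l_def lambar_def
      by (rule avg_mono) (use step_le_lam del_nonneg in \<open>simp add: add_increasing2\<close>)
    finally have "L2 * norm s \<le> l"
      using mult_right_mono[OF L2_le_M, of "norm s"] by simp
    then have "L2 / 2 * (norm s)\<^sup>2 \<le> 1 / 2 * l * norm s"
      using mult_right_mono[of "L2 * norm s" l "norm s / 2"] by (simp add: power2_eq_square)
    then show ?thesis
      by (intro norm_avg_le_bound order_trans[OF f.grad_Taylor])
  qed
  have A: "norm (A_ref M r k *v (s - s_ref M r k)) \<le> 1 / 96 * l * norm s"
  proof (cases "L1 + l = 0")
    case True
    then show ?thesis
      using A_ref_upper[of k "s - s_ref M r k"] l by (simp add: l_def mult_nonneg_nonneg)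
  next
    case False
    then have "0 < L1 + l" using l L1_nonneg by simp
    then have "(L1 + l) * norm (s - s_ref M r k) \<le> 1 / 96 * l * norm s"
      using b1 by (simp add: field_simps)
    then show ?thesis using A_ref_upper[of k "s - s_ref M r k"] by (simp add: l_def)
  qed
  have Hd: "norm (avg (mH r k) *v s - avg (\<lambda>i. hess (f i) x *v s)) \<le> 1 / 96 * l * norm s"
    using hessian_tracking[of k s] mult_right_mono[OF b3 norm_ge_zero, of s] by (simp add: x_def)
  have Gd: "norm (avg (mG r k) - gbar f r k) \<le> 1 / 96 * l * norm s"
    using gradient_tracking[of k] b2 by linarith
  have "gbar f r (Suc k) + l *\<^sub>R s
      = avg (\<lambda>i. grad (f i) (x + s) - grad (f i) x - hess (f i) x *v s)
        + A_ref M r k *v (s - s_ref M r k)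
        - (avg (mH r k) *v s - avg (\<lambda>i. hess (f i) x *v s)) - (avg (mG r k) - gbar f r k)"
    using A_ref_s_ref[OF inv] A_ref_mult[of k s]
    by (simp add: gbar_eq avg_diff avg_X_Suc x_def s_def l_def matrix_vector_mult_diff_distrib)
  moreover have "norm (a + b - c - d) \<le> norm a + norm b + norm c + norm d" for a b c d :: "real^'d"
    using norm_triangle_ineq4[of "a + b - c" d] norm_triangle_ineq4[of "a + b" c]
      norm_triangle_ineq[of a b] by linarith
  ultimately have "norm (gbar f r (Suc k) + l *\<^sub>R s)
      \<le> norm (avg (\<lambda>i. grad (f i) (x + s) - grad (f i) x - hess (f i) x *v s))
        + norm (A_ref M r k *v (s - s_ref M r k))
        + norm (avg (mH r k) *v s - avg (\<lambda>i. hess (f i) x *v s)) + norm (avg (mG r k) - gbar f r k)"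
    by presburger
  moreover have "0 \<le> l * norm s" using l by simp
  ultimately show ?thesis
    using T A Hd Gd unfolding l_def[symmetric] s_def[symmetric] by linarith
qed

lemma objective_decrease:
  assumes "burn_in L1 L2 M f r \<epsilon> K0" "K0 \<le> k" "\<epsilon> \<le> norm (gbar f r k)"
  shows "(norm (gbar f r (Suc k)))\<^sup>2
    \<le> 16 * regularisation_bound M C * (favg f (avg (X r k)) - favg f (avg (X r (Suc k))))"
proof -
  define l where "l = lambar M r k"
  define s where "s = avg (S r k)"
  define y where "y = gbar f r (Suc k)"
  have near: "norm (y + l *\<^sub>R s) \<le> 3 / 4 * l * norm s"
    using next_gradient[OF assms] by (simp add: l_def s_def y_def)
  have l: "0 \<le> l" by (simp add: l_def lambar_nonneg)
  have "l * (norm s)\<^sup>2 + y \<bullet> s = (y + l *\<^sub>R s) \<bullet> s"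
    by (simp add: inner_add_left dot_square_norm)
  also have "\<dots> \<le> 3 / 4 * l * norm s * norm s"
    using norm_cauchy_schwarz[of "y + l *\<^sub>R s" s] mult_right_mono[OF near norm_ge_zero, of s]
    by linarith
  finally have "1 / 4 * (l * (norm s)\<^sup>2) \<le> - (y \<bullet> s)"
    by (simp add: power2_eq_square)
  also have "\<dots> \<le> favg f (avg (X r k)) - favg f (avg (X r (Suc k)))"
    using favg_above_tangent[of "avg (X r (Suc k))" "avg (X r k)"]
    unfolding gbar_eq[symmetric] y_def[symmetric] by (simp add: avg_X_Suc s_def)
  finally have dec: "l * (norm s)\<^sup>2 \<le> 4 * (favg f (avg (X r k)) - favg f (avg (X r (Suc k))))"
    by simp
  have "0 \<le> l * norm s" using l by simp
  moreover have "norm y \<le> norm (y + l *\<^sub>R s) + l * norm s"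
    using norm_triangle_ineq4[of "y + l *\<^sub>R s" "l *\<^sub>R s"] l by simp
  ultimately have "norm y \<le> 2 * (l * norm s)" using near by linarith
  then have "(norm y)\<^sup>2 \<le> (2 * (l * norm s))\<^sup>2" by (intro power_mono) auto
  also have "\<dots> = 4 * l * (l * (norm s)\<^sup>2)" by (simp add: power2_eq_square)
  also have "\<dots> \<le> 4 * regularisation_bound M C * (l * (norm s)\<^sup>2)"
    using lambar_le[of k] l by (intro mult_right_mono) (auto simp: l_def)
  also have "\<dots> \<le> 4 * regularisation_bound M C
      * (4 * (favg f (avg (X r k)) - favg f (avg (X r (Suc k)))))"
    using dec lambar_le[of k] l by (intro mult_left_mono) (auto simp: l_def)
  finally show ?thesis by (simp add: y_def algebra_simps)
qed

end

section \<open>From the decrease of the objective to the hitting time\<close>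

text \<open>The inductive bound \<open>a j \<le> B / (j + 1)\<close> on the gap starts if \<open>A \<le> B\<close>, and it is inherited
  if \<open>2 D\<^sup>2 Q \<le> B\<close>; this \<open>B\<close> meets both conditions.\<close>

definition gap_bound :: "real \<Rightarrow> real \<Rightarrow> real \<Rightarrow> real" where
  "gap_bound D Q A = A + 2 * (D\<^sup>2 * Q)"

text \<open>While the gradient norm \<open>y\<close> stays above \<open>\<epsilon>\<close>, the gap \<open>a\<close> satisfies
  \<open>a (Suc j)\<^sup>2 \<le> D\<^sup>2 Q (a j - a (Suc j))\<close>, so it is \<open>O(1/j)\<close> and at most \<open>O(\<epsilon>)\<close> after about
  \<open>1/\<epsilon>\<close> steps.  From then on every step decreases it by at least \<open>\<epsilon>\<^sup>2 / Q\<close>, so only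
  \<open>O(1/\<epsilon>)\<close> further steps are possible.\<close>

lemma small_gradient_index:
  fixes a y :: "nat \<Rightarrow> real"
  assumes \<epsilon>: "0 < \<epsilon>" "\<epsilon> \<le> 1" and pos: "0 < D" "0 < Q"
    and a0: "a 0 \<le> A" and a_nonneg: "\<And>j. 0 \<le> a j" and gap: "\<And>j. a j \<le> D * y j"
    and dec: "\<And>j. \<epsilon> \<le> y j \<Longrightarrow> (y (Suc j))\<^sup>2 \<le> Q * (a j - a (Suc j))"
  shows "\<exists>j. y j \<le> \<epsilon> \<and> real j \<le> (3 + Q * gap_bound D Q A) * (1 / \<epsilon>)"
proof -
  define B where "B = gap_bound D Q A"
  have B: "A \<le> B" "2 * (D\<^sup>2 * Q) \<le> B" "0 < B"
  proof -
    have "0 \<le> A" "0 < D\<^sup>2 * Q" using a0 a_nonneg[of 0] pos by auto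
    then show "A \<le> B" "2 * (D\<^sup>2 * Q) \<le> B" "0 < B"
      unfolding B_def gap_bound_def by linarith+
  qed
  define m where "m = nat \<lceil>1 / \<epsilon>\<rceil>"
  define n where "n = Suc (nat \<lfloor>Q * B / \<epsilon>\<rfloor>)"
  have m: "1 / \<epsilon> \<le> real m" "real m \<le> 1 / \<epsilon> + 1"
  proof -
    have "0 \<le> 1 / \<epsilon>" using \<epsilon> by simp
    then show "1 / \<epsilon> \<le> real m" "real m \<le> 1 / \<epsilon> + 1" unfolding m_def by linarith+
  qed
  have QB: "0 \<le> Q * B / \<epsilon>" using pos B \<epsilon> by simp
  have n: "Q * B / \<epsilon> < real n" "real n \<le> Q * B / \<epsilon> + 1"
    unfolding n_def using QB by linarith+
  have "\<exists>j\<le>m + n. y j \<le> \<epsilon>"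
  proof (rule ccontr)
    assume "\<not> ?thesis"
    then have y: "\<epsilon> < y j" if "j \<le> m + n" for j using that not_le by blast
    have decr: "(y (Suc j))\<^sup>2 \<le> Q * (a j - a (Suc j))" if "j \<le> m + n" for j
      using dec y[OF that] by simp
    have gap_j: "a j \<le> B / (real j + 1)" if "j \<le> m + n" for j
      using that
    proof (induction j)
      case 0
      then show ?case using a0 B by simp
    next
      case (Suc j)
      then have IH: "a j \<le> B / (real j + 1)" by simp
      show ?case
      proof (rule ccontr)
        assume "\<not> ?thesis"
        then have big: "B / (real j + 2) < a (Suc j)" by (simp add: add.commute)
        have "(B / (real j + 2))\<^sup>2 \<le> (a (Suc j))\<^sup>2"
          using big B by (intro power_mono) auto
        also have "\<dots> \<le> (D * y (Suc j))\<^sup>2"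
          using gap a_nonneg by (intro power_mono) auto
        also have "\<dots> = D\<^sup>2 * (y (Suc j))\<^sup>2" by (simp add: power_mult_distrib)
        also have "\<dots> \<le> D\<^sup>2 * (Q * (a j - a (Suc j)))"
          using decr[of j] Suc.prems by (intro mult_left_mono) auto
        also have "\<dots> < D\<^sup>2 * (Q * (B / (real j + 1) - B / (real j + 2)))"
          using IH big pos by (intro mult_strict_left_mono) auto
        also have "\<dots> = D\<^sup>2 * Q * (B / ((real j + 1) * (real j + 2)))"
          by (simp add: field_simps)
        also have "\<dots> \<le> B / 2 * (B / ((real j + 1) * (real j + 2)))"
          using B by (intro mult_right_mono) auto
        also have "\<dots> = B * B / (2 * (real j + 1) * (real j + 2))" by simp
        also have "\<dots> \<le> B * B / ((real j + 2) * (real j + 2))"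
          by (intro divide_left_mono mult_right_mono) auto
        also have "\<dots> = (B / (real j + 2))\<^sup>2" by (simp add: power2_eq_square)
        finally show False by simp
      qed
    qed
    have "1 \<le> \<epsilon> * (real m + 1)"
      using m(1) \<epsilon> by (simp add: field_simps)
    then have "B * 1 \<le> B * (\<epsilon> * (real m + 1))"
      using B by (intro mult_left_mono) auto
    then have "B / (real m + 1) \<le> B * \<epsilon>" by (simp add: divide_le_eq mult.assoc)
    then have am: "a m \<le> B * \<epsilon>" using gap_j[of m] by simp
    have "real i * \<epsilon>\<^sup>2 \<le> Q * (a m - a (m + i))" if "i \<le> n" for i
      using that
    proof (induction i)
      case (Suc i)
      have "\<epsilon>\<^sup>2 \<le> (y (Suc (m + i)))\<^sup>2"
        using y[of "Suc (m + i)"] Suc.prems \<epsilon> by (intro power_mono) auto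
      then have "\<epsilon>\<^sup>2 \<le> Q * (a (m + i) - a (m + Suc i))"
        using decr[of "m + i"] Suc.prems by simp
      then show ?case using Suc by (simp add: algebra_simps)
    qed simp
    then have "real n * \<epsilon>\<^sup>2 \<le> Q * (a m - a (m + n))" by simp
    also have "\<dots> \<le> Q * (B * \<epsilon>)"
      using am a_nonneg[of "m + n"] pos by (intro mult_left_mono) auto
    finally have "real n * \<epsilon> * \<epsilon> \<le> Q * B * \<epsilon>" by (simp add: power2_eq_square ac_simps)
    then have "real n * \<epsilon> \<le> Q * B" using \<epsilon> by simp
    then show False using n(1) \<epsilon> by (simp add: field_simps)
  qed
  then obtain j where j: "j \<le> m + n" "y j \<le> \<epsilon>" by blast
  have "real j \<le> real m + real n" using j(1) by simp
  also have "\<dots> \<le> 1 / \<epsilon> + Q * B / \<epsilon> + 2" using m(2) n(2) by linarith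
  also have "\<dots> \<le> (3 + Q * B) * (1 / \<epsilon>)"
    using \<epsilon> by (simp add: field_simps)
  finally show ?thesis using j(2) unfolding B_def by blast
qed

definition iteration_bound :: "real \<Rightarrow> real \<Rightarrow> real \<Rightarrow> real" where
  "iteration_bound D M C = (let Q = 16 * regularisation_bound M C in 3 + Q * gap_bound D Q (D * C))"

lemma (in disgrem_run) iterations_after_burn_in:
  assumes \<epsilon>: "0 < \<epsilon>" "\<epsilon> \<le> 1" and "0 < D" and burn: "burn_in L1 L2 M f r \<epsilon> K0"
  shows "\<exists>k. norm (gbar f r k) \<le> \<epsilon> \<and> real k \<le> real K0 + iteration_bound D M C * (1 / \<epsilon>)"
proof -
  obtain xs where xs: "\<And>y. favg f xs \<le> favg f y" "\<And>k. norm (avg (X r k) - xs) \<le> D"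
    using bounded unfolding bounded_iterates_def by blast
  define a where "a j = favg f (avg (X r (K0 + j))) - favg f xs" for j
  define y where "y j = norm (gbar f r (K0 + j))" for j
  define Q where "Q = 16 * regularisation_bound M C"
  have "0 < Q"
  proof -
    have "0 \<le> sqrt (M * C)" using C_ge_1 M_pos by simp
    then have "0 < regularisation_bound M C"
      using C_ge_1 unfolding regularisation_bound_def by linarith
    then show ?thesis by (simp add: Q_def)
  qed
  have gap: "a j \<le> D * y j" for j
  proof -
    let ?x = "avg (X r (K0 + j))"
    have "a j \<le> gbar f r (K0 + j) \<bullet> (?x - xs)"
      using favg_above_tangent[of ?x xs] unfolding gbar_eq[symmetric]
      by (simp add: a_def inner_diff_right)
    also have "\<dots> \<le> y j * norm (?x - xs)"
      unfolding y_def by (rule norm_cauchy_schwarz)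
    also have "\<dots> \<le> y j * D"
      using xs(2) by (intro mult_left_mono) (auto simp: y_def)
    finally show ?thesis by (simp only: mult.commute)
  qed
  have "\<exists>j. y j \<le> \<epsilon> \<and> real j \<le> (3 + Q * gap_bound D Q (D * C)) * (1 / \<epsilon>)"
  proof (rule small_gradient_index[OF \<epsilon> \<open>0 < D\<close> \<open>0 < Q\<close>])
    show "a 0 \<le> D * C"
      using run_bounds(7)[of K0] \<open>0 < D\<close>
      by (intro order_trans[OF gap] mult_left_mono) (auto simp: y_def)
    show "0 \<le> a j" for j using xs(1) by (simp add: a_def)
    show "(y (Suc j))\<^sup>2 \<le> Q * (a j - a (Suc j))" if "\<epsilon> \<le> y j" for j
      using objective_decrease[OF burn, of "K0 + j"] that by (simp add: Q_def a_def y_def)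
  qed (rule gap)
  then obtain j where "y j \<le> \<epsilon>" "real j \<le> (3 + Q * gap_bound D Q (D * C)) * (1 / \<epsilon>)" by blast
  then show ?thesis
    by (intro exI[of _ "K0 + j"]) (simp add: y_def iteration_bound_def Let_def flip: Q_def)
qed

section \<open>The logarithmic schedule\<close>

lemma log_schedule_contraction:
  assumes "0 < \<rho>" "\<rho> < 1" "3 \<le> p" "0 \<le> c"
  shows "\<rho> ^ log_schedule p c \<rho> k \<le> decay (Suc k)"
proof -
  have neg: "0 < - ln \<rho>" using assms by simp
  have "(p * ln (real k + 2) + c) / (- ln \<rho>) \<le> real (log_schedule p c \<rho> k)"
    unfolding log_schedule_def by (rule real_nat_ceiling_ge)
  then have "p * ln (real k + 2) + c \<le> real (log_schedule p c \<rho> k) * (- ln \<rho>)"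
    using neg by (simp only: pos_divide_le_eq)
  moreover have "3 * ln (real k + 2) \<le> p * ln (real k + 2)"
    using assms by (intro mult_right_mono) auto
  ultimately have "real (log_schedule p c \<rho> k) * ln \<rho> \<le> - (3 * ln (real k + 2))"
    using assms(4) by linarith
  then have "exp (real (log_schedule p c \<rho> k) * ln \<rho>) \<le> exp (- (3 * ln (real k + 2)))" by simp
  moreover have "exp (real (log_schedule p c \<rho> k) * ln \<rho>) = \<rho> ^ log_schedule p c \<rho> k"
    using assms by (simp add: exp_of_nat_mult)
  moreover have "exp (- (3 * ln (real k + 2))) = decay (Suc k)"
    using exp_of_nat_mult[of 3 "ln (real k + 2)"] by (simp add: decay_def exp_minus inverse_eq_divide add.commute)
  ultimately show ?thesis by simp
qed

lemma log_schedule_le: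
  assumes "0 < \<rho>" "\<rho> < 1" "0 \<le> p" "0 \<le> c"
  shows "real (log_schedule p c \<rho> k) \<le> (p * ln (real k + 2) + c + 1) / (1 - \<rho>)"
proof -
  have rate: "1 - \<rho> \<le> - ln \<rho>" using ln_le_minus_one[of \<rho>] assms by simp
  have num: "0 \<le> p * ln (real k + 2) + c" using assms by simp
  have "real (log_schedule p c \<rho> k) \<le> (p * ln (real k + 2) + c) / (- ln \<rho>) + 1"
  proof -
    have "0 \<le> (p * ln (real k + 2) + c) / (- ln \<rho>)"
      using num rate assms by (intro divide_nonneg_nonneg) linarith+
    then show ?thesis unfolding log_schedule_def by linarith
  qed
  also have "\<dots> \<le> (p * ln (real k + 2) + c) / (1 - \<rho>) + 1 / (1 - \<rho>)"
    using rate num assms by (intro add_mono divide_left_mono mult_pos_pos) (auto simp: field_simps)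
  finally show ?thesis by (simp add: add_divide_distrib)
qed

text \<open>The absolute value keeps this positive for every \<open>B\<close>.\<close>

definition comm_bound :: "real \<Rightarrow> real \<Rightarrow> real \<Rightarrow> real" where
  "comm_bound p c B = 3 * (\<bar>B\<bar> + 1) * (p * (ln (\<bar>B\<bar> + 2) / ln 2 + 1) + (c + 1) / ln 2)"

lemma comm_bound_pos: "0 < p \<Longrightarrow> 0 \<le> c \<Longrightarrow> 0 < comm_bound p c B"
  unfolding comm_bound_def
  by (intro mult_pos_pos add_pos_nonneg divide_nonneg_nonneg add_nonneg_pos) auto

text \<open>Constants are absorbed into \<open>ln (1 / \<epsilon>)\<close>, which is at least \<open>ln 2\<close>.\<close>

lemma comm_rounds_le:
  assumes \<rho>: "0 < \<rho>" "\<rho> < 1" and p: "0 < p" and c: "0 \<le> c" and \<epsilon>: "0 < \<epsilon>" "\<epsilon> \<le> 1 / 2"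
    and n: "real n \<le> B * (1 / \<epsilon>)"
  shows "real (comm_rounds (log_schedule p c \<rho>) (log_schedule p c \<rho>) n)
    \<le> comm_bound p c B * (1 / (1 - \<rho>) * (1 / \<epsilon>) * ln (1 / \<epsilon>))"
proof -
  define l where "l = ln (1 / \<epsilon>)"
  define Y where "Y = p * (ln (\<bar>B\<bar> + 2) / ln 2 + 1) + (c + 1) / ln 2"
  have l: "ln 2 \<le> l" unfolding l_def using \<epsilon> by (simp add: field_simps)
  have l0: "0 < l" using l ln_gt_zero[of "2::real"] by linarith
  have absorb: "x \<le> x / ln 2 * l" if "0 \<le> x" for x :: real
    using mult_left_mono[OF l, of "x / ln 2"] that by simp
  have nB: "real n \<le> (\<bar>B\<bar> + 1) * (1 / \<epsilon>)"
    using \<epsilon> by (intro order_trans[OF n] mult_right_mono) auto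
  have "ln (real k + 2) \<le> (ln (\<bar>B\<bar> + 2) / ln 2 + 1) * l" if "k < n" for k
  proof -
    have "real k + 2 \<le> real n + 1" using that by simp
    also have "\<dots> \<le> (\<bar>B\<bar> + 1) * (1 / \<epsilon>) + 1 / \<epsilon>"
      using nB \<epsilon> by (intro add_mono) auto
    also have "\<dots> = (\<bar>B\<bar> + 2) * (1 / \<epsilon>)" by (simp add: add_divide_distrib)
    finally have "real k + 2 \<le> (\<bar>B\<bar> + 2) * (1 / \<epsilon>)" .
    then have "ln (real k + 2) \<le> ln ((\<bar>B\<bar> + 2) * (1 / \<epsilon>))"
      by (subst ln_le_cancel_iff) (use \<epsilon> in auto)
    also have "\<dots> = ln (\<bar>B\<bar> + 2) + l"
      unfolding l_def using \<epsilon> by (subst ln_mult_pos) auto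
    also have "\<dots> \<le> (ln (\<bar>B\<bar> + 2) / ln 2 + 1) * l"
      using absorb[of "ln (\<bar>B\<bar> + 2)"] by (simp add: distrib_right)
    finally show ?thesis .
  qed
  then have "p * ln (real k + 2) \<le> p * ((ln (\<bar>B\<bar> + 2) / ln 2 + 1) * l)" if "k < n" for k
    using that p by (intro mult_left_mono) auto
  moreover have "c + 1 \<le> (c + 1) / ln 2 * l" using c by (intro absorb) simp
  ultimately have "p * ln (real k + 2) + c + 1 \<le> Y * l" if "k < n" for k
    using that unfolding Y_def by (fastforce simp: distrib_right[of _ _ l] mult.assoc)
  then have t: "real (log_schedule p c \<rho> k) \<le> Y * l / (1 - \<rho>)" if "k < n" for k
    using order_trans[OF log_schedule_le[OF \<rho> less_imp_le[OF p] c] divide_right_mono] \<rho> that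
    by simp
  have Y: "0 \<le> Y" using p c by (simp add: Y_def)
  have "real (comm_rounds (log_schedule p c \<rho>) (log_schedule p c \<rho>) n)
      = (\<Sum>k<n. 3 * real (log_schedule p c \<rho> k))"
    by (simp add: comm_rounds_def)
  also have "\<dots> \<le> (\<Sum>k<n. 3 * (Y * l / (1 - \<rho>)))"
    by (intro sum_mono mult_left_mono t) auto
  also have "\<dots> = real n * (3 * (Y * l / (1 - \<rho>)))" by simp
  also have "\<dots> \<le> (\<bar>B\<bar> + 1) * (1 / \<epsilon>) * (3 * (Y * l / (1 - \<rho>)))"
    using nB Y l0 \<rho> by (intro mult_right_mono) auto
  finally show ?thesis
    unfolding comm_bound_def Y_def[symmetric] l_def[symmetric]
    by (simp only: divide_inverse mult_1_left ac_simps)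
qed

section \<open>Complexity of DisGrem\<close>

text \<open>Linear growth of the index suffices: \<open>decay k\<close> is of order \<open>\<epsilon>\<^sup>3\<close> once \<open>k\<close> is of order
  \<open>1/\<epsilon>\<close>.\<close>

lemma burn_in_index:
  assumes \<epsilon>: "0 < \<epsilon>" "\<epsilon> \<le> 1" and K: "K \<le> K'" "1 \<le> K'"
  shows "K * decay (nat \<lceil>K' * (1 / \<epsilon>)\<rceil>) \<le> \<epsilon> ^ 3"
proof -
  define k where "k = nat \<lceil>K' * (1 / \<epsilon>)\<rceil>"
  have "K' * (1 / \<epsilon>) \<le> real k + 1"
    unfolding k_def using real_nat_ceiling_ge[of "K' * (1 / \<epsilon>)"] by linarith
  then have "(K' * (1 / \<epsilon>)) ^ 3 \<le> (real k + 1) ^ 3"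
    using \<epsilon> K by (intro power_mono) auto
  then have "K' ^ 3 \<le> \<epsilon> ^ 3 * (real k + 1) ^ 3"
    using \<epsilon> by (simp add: power_divide field_simps)
  moreover have "K' ^ 1 \<le> K' ^ 3" using K by (intro power_increasing) auto
  ultimately have "K \<le> \<epsilon> ^ 3 * (real k + 1) ^ 3" using K by simp
  then show ?thesis
    unfolding k_def[symmetric] by (simp add: decay_def divide_le_eq)
qed

theorem theorem5p20:
  fixes p c_mix L1 L2 D M :: real
    and x0 g0 :: "'n::finite \<Rightarrow> real^'d::finite"
    and H0 :: "'n \<Rightarrow> real^'d^'d"
  assumes "3 \<le> p" and "0 \<le> c_mix" and "0 < M" and "L2 \<le> M" and "0 < D"
  shows "\<exists>C_net :: real \<Rightarrow> real. (\<forall>B. 0 < C_net B) \<and>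
    (\<forall>\<rho>. 0 < \<rho> \<and> \<rho> < 1 \<longrightarrow>
      (\<exists>C_K C_0 C_it C_comm :: real. \<exists>K0 :: real \<Rightarrow> nat.
        0 < C_K \<and> 0 < C_0 \<and> 0 < C_it \<and> 0 < C_comm \<and>
        (\<forall>\<epsilon>. 0 < \<epsilon> \<and> \<epsilon> \<le> 1 \<longrightarrow> real (K0 \<epsilon>) \<le> C_0 * (1 / \<epsilon>)) \<and>
        (\<forall>(f :: 'n \<Rightarrow> real^'d \<Rightarrow> real) (W :: real^'n^'n) (r :: ('d, 'n) run).
          smooth_convex f L1 L2 \<and> mixing_matrix W \<and> mixing_rate W = \<rho> \<and> coercive (favg f) \<and>
          disgrem f W M (log_schedule p c_mix \<rho>) (log_schedule p c_mix \<rho>) r \<and>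
          X r 0 = x0 \<and> G r 0 = g0 \<and> H r 0 = H0 \<and>
          bounded_iterates f D r \<longrightarrow>
            (\<forall>\<epsilon>. 0 < \<epsilon> \<and> \<epsilon> \<le> 1 \<longrightarrow>
               burn_in L1 L2 M f r \<epsilon> (K0 \<epsilon>) \<and>
               reaches f r \<epsilon> \<and>
               real (hit_time f r \<epsilon>) \<le> real (K0 \<epsilon>) + C_K * (1 / \<epsilon>) \<and>
               real (hit_time f r \<epsilon>) \<le> C_it * (1 / \<epsilon>)) \<and>
            (\<forall>\<epsilon>. 0 < \<epsilon> \<and> \<epsilon> \<le> 1 / 2 \<longrightarrow>
               real (comm_rounds (log_schedule p c_mix \<rho>) (log_schedule p c_mix \<rho>) (hit_time f r \<epsilon>))
                 \<le> C_comm * (1 / \<epsilon> * ln (1 / \<epsilon>))) \<and>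
            (\<forall>B. (\<forall>\<epsilon>. 0 < \<epsilon> \<and> \<epsilon> \<le> 1 \<longrightarrow> real (hit_time f r \<epsilon>) \<le> B * (1 / \<epsilon>)) \<longrightarrow>
               (\<forall>\<epsilon>. 0 < \<epsilon> \<and> \<epsilon> \<le> 1 / 2 \<longrightarrow>
                 real (comm_rounds (log_schedule p c_mix \<rho>) (log_schedule p c_mix \<rho>) (hit_time f r \<epsilon>))
                   \<le> C_net B * (1 / (1 - \<rho>) * (1 / \<epsilon>) * ln (1 / \<epsilon>)))))))"
proof (intro exI[of _ "comm_bound p c_mix"] conjI allI impI)
  show "0 < comm_bound p c_mix B" for B
    using assms by (intro comm_bound_pos) auto
next
  fix \<rho> :: real assume \<rho>: "0 < \<rho> \<and> \<rho> < 1"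
  define C where "C = run_bound L1 L2 D M g0 H0"
  (* The maxima with 1 keep the constants positive when no run with these data exists;
     burn_in_index also relies on K' being at least 1. *)
  define C_K where "C_K = max 1 (iteration_bound D M C)"
  define K' where "K' = max 1 (burn_in_bound L1 L2 M C)"
  define C_0 where "C_0 = K' + 1"
  define C_it where "C_it = C_0 + C_K"
  define C_comm where "C_comm = comm_bound p c_mix C_it / (1 - \<rho>)"
  define K0 where "K0 \<epsilon> = nat \<lceil>K' * (1 / \<epsilon>)\<rceil>" for \<epsilon> :: real
  have pos: "0 < C_K" "0 < C_0" "0 < C_it" by (auto simp: C_K_def C_0_def C_it_def K'_def)
  have "0 < C_comm"
    using \<rho> assms by (auto simp: C_comm_def intro!: divide_pos_pos comm_bound_pos)
  have K0_le: "real (K0 \<epsilon>) \<le> C_0 * (1 / \<epsilon>)" if "0 < \<epsilon>" "\<epsilon> \<le> 1" for \<epsilon>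
  proof -
    have "0 \<le> K' * (1 / \<epsilon>)" using that by (simp add: K'_def)
    then have "real (K0 \<epsilon>) \<le> K' * (1 / \<epsilon>) + 1"
      unfolding K0_def by (simp add: of_nat_nat)
    also have "\<dots> \<le> C_0 * (1 / \<epsilon>)"
      using that by (simp add: C_0_def field_simps)
    finally show ?thesis .
  qed
  let ?T = "log_schedule p c_mix \<rho>"
  have run: "(\<forall>\<epsilon>. 0 < \<epsilon> \<and> \<epsilon> \<le> 1 \<longrightarrow> burn_in L1 L2 M f r \<epsilon> (K0 \<epsilon>) \<and> reaches f r \<epsilon> \<and>
        real (hit_time f r \<epsilon>) \<le> real (K0 \<epsilon>) + C_K * (1 / \<epsilon>) \<and>
        real (hit_time f r \<epsilon>) \<le> C_it * (1 / \<epsilon>)) \<and>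
      (\<forall>\<epsilon>. 0 < \<epsilon> \<and> \<epsilon> \<le> 1 / 2 \<longrightarrow>
        real (comm_rounds ?T ?T (hit_time f r \<epsilon>)) \<le> C_comm * (1 / \<epsilon> * ln (1 / \<epsilon>))) \<and>
      (\<forall>B. (\<forall>\<epsilon>. 0 < \<epsilon> \<and> \<epsilon> \<le> 1 \<longrightarrow> real (hit_time f r \<epsilon>) \<le> B * (1 / \<epsilon>)) \<longrightarrow>
        (\<forall>\<epsilon>. 0 < \<epsilon> \<and> \<epsilon> \<le> 1 / 2 \<longrightarrow> real (comm_rounds ?T ?T (hit_time f r \<epsilon>))
          \<le> comm_bound p c_mix B * (1 / (1 - \<rho>) * (1 / \<epsilon>) * ln (1 / \<epsilon>))))"
    if H: "smooth_convex f L1 L2 \<and> mixing_matrix W \<and> mixing_rate W = \<rho> \<and> coercive (favg f) \<and>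
      disgrem f W M ?T ?T r \<and> X r 0 = x0 \<and> G r 0 = g0 \<and> H r 0 = H0 \<and> bounded_iterates f D r"
    for f :: "'n \<Rightarrow> real^'d \<Rightarrow> real" and W :: "real^'n^'n" and r :: "('d, 'n) run"
  proof -
    interpret disgrem_run f W r ?T L1 L2 D M
      using H assms \<rho> log_schedule_contraction[of \<rho> p c_mix] by unfold_locales auto
    have C: "run_bound L1 L2 D M (G r 0) (H r 0) = C" using H by (simp add: C_def)
    have hit: "burn_in L1 L2 M f r \<epsilon> (K0 \<epsilon>) \<and> reaches f r \<epsilon> \<and>
        real (hit_time f r \<epsilon>) \<le> real (K0 \<epsilon>) + C_K * (1 / \<epsilon>) \<and>
        real (hit_time f r \<epsilon>) \<le> C_it * (1 / \<epsilon>)" if \<epsilon>: "0 < \<epsilon>" "\<epsilon> \<le> 1" for \<epsilon>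
    proof -
      have burn: "burn_in L1 L2 M f r \<epsilon> (K0 \<epsilon>)"
        using burn_in_if_small_decay[OF \<epsilon>] burn_in_index[OF \<epsilon>, of "burn_in_bound L1 L2 M C" K']
        by (simp add: C K0_def K'_def)
      obtain k where k: "norm (gbar f r k) \<le> \<epsilon>"
        "real k \<le> real (K0 \<epsilon>) + iteration_bound D M C * (1 / \<epsilon>)"
        using iterations_after_burn_in[OF \<epsilon> \<open>0 < D\<close> burn] unfolding C by blast
      have "hit_time f r \<epsilon> \<le> k" unfolding hit_time_def by (rule Least_le) (rule k)
      moreover have "iteration_bound D M C * (1 / \<epsilon>) \<le> C_K * (1 / \<epsilon>)"
        using \<epsilon> by (intro mult_right_mono) (auto simp: C_K_def)
      ultimately have "real (hit_time f r \<epsilon>) \<le> real (K0 \<epsilon>) + C_K * (1 / \<epsilon>)"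
        using k(2) by linarith
      moreover from this have "real (hit_time f r \<epsilon>) \<le> C_it * (1 / \<epsilon>)"
        using K0_le[OF \<epsilon>] unfolding C_it_def distrib_right by linarith
      ultimately show ?thesis using burn k(1) by (auto simp: reaches_def)
    qed
    have comm: "real (comm_rounds ?T ?T (hit_time f r \<epsilon>))
        \<le> comm_bound p c_mix B * (1 / (1 - \<rho>) * (1 / \<epsilon>) * ln (1 / \<epsilon>))"
      if "0 < \<epsilon>" "\<epsilon> \<le> 1 / 2" "real (hit_time f r \<epsilon>) \<le> B * (1 / \<epsilon>)" for \<epsilon> B
      using comm_rounds_le[of \<rho> p c_mix \<epsilon>] \<rho> assms that by simp
    show ?thesis
    proof (intro conjI allI impI)
      fix \<epsilon> :: real assume \<epsilon>: "0 < \<epsilon> \<and> \<epsilon> \<le> 1 / 2"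
      then have "real (hit_time f r \<epsilon>) \<le> C_it * (1 / \<epsilon>)" using hit[of \<epsilon>] by simp
      from comm[OF _ _ this] \<epsilon>
      show "real (comm_rounds ?T ?T (hit_time f r \<epsilon>)) \<le> C_comm * (1 / \<epsilon> * ln (1 / \<epsilon>))"
        by (simp add: C_comm_def)
    next
      fix B \<epsilon> :: real
      assume "\<forall>\<epsilon>. 0 < \<epsilon> \<and> \<epsilon> \<le> 1 \<longrightarrow> real (hit_time f r \<epsilon>) \<le> B * (1 / \<epsilon>)" "0 < \<epsilon> \<and> \<epsilon> \<le> 1 / 2"
      then show "real (comm_rounds ?T ?T (hit_time f r \<epsilon>))
          \<le> comm_bound p c_mix B * (1 / (1 - \<rho>) * (1 / \<epsilon>) * ln (1 / \<epsilon>))"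
        by (intro comm) auto
    qed (use hit in blast)+
  qed
  show "\<exists>C_K C_0 C_it C_comm :: real. \<exists>K0 :: real \<Rightarrow> nat.
        0 < C_K \<and> 0 < C_0 \<and> 0 < C_it \<and> 0 < C_comm \<and>
        (\<forall>\<epsilon>. 0 < \<epsilon> \<and> \<epsilon> \<le> 1 \<longrightarrow> real (K0 \<epsilon>) \<le> C_0 * (1 / \<epsilon>)) \<and>
        (\<forall>(f :: 'n \<Rightarrow> real^'d \<Rightarrow> real) (W :: real^'n^'n) (r :: ('d, 'n) run).
          smooth_convex f L1 L2 \<and> mixing_matrix W \<and> mixing_rate W = \<rho> \<and> coercive (favg f) \<and>
          disgrem f W M ?T ?T r \<and> X r 0 = x0 \<and> G r 0 = g0 \<and> H r 0 = H0 \<and>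
          bounded_iterates f D r \<longrightarrow>
            (\<forall>\<epsilon>. 0 < \<epsilon> \<and> \<epsilon> \<le> 1 \<longrightarrow>
               burn_in L1 L2 M f r \<epsilon> (K0 \<epsilon>) \<and> reaches f r \<epsilon> \<and>
               real (hit_time f r \<epsilon>) \<le> real (K0 \<epsilon>) + C_K * (1 / \<epsilon>) \<and>
               real (hit_time f r \<epsilon>) \<le> C_it * (1 / \<epsilon>)) \<and>
            (\<forall>\<epsilon>. 0 < \<epsilon> \<and> \<epsilon> \<le> 1 / 2 \<longrightarrow>
               real (comm_rounds ?T ?T (hit_time f r \<epsilon>)) \<le> C_comm * (1 / \<epsilon> * ln (1 / \<epsilon>))) \<and>
            (\<forall>B. (\<forall>\<epsilon>. 0 < \<epsilon> \<and> \<epsilon> \<le> 1 \<longrightarrow> real (hit_time f r \<epsilon>) \<le> B * (1 / \<epsilon>)) \<longrightarrow>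
               (\<forall>\<epsilon>. 0 < \<epsilon> \<and> \<epsilon> \<le> 1 / 2 \<longrightarrow>
                 real (comm_rounds ?T ?T (hit_time f r \<epsilon>))
                   \<le> comm_bound p c_mix B * (1 / (1 - \<rho>) * (1 / \<epsilon>) * ln (1 / \<epsilon>)))))"
    by (rule exI[of _ C_K], rule exI[of _ C_0], rule exI[of _ C_it], rule exI[of _ C_comm],
        rule exI[of _ K0], intro conjI pos \<open>0 < C_comm\<close>)
      (use K0_le in blast, use run in blast)
qed

end
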